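(* Let $n$ be a positive integer. For $a,b\in\mathbb{Z}$ set $N := \frac{1}{6}(-3a+b-1)$ and $\tilde N := \frac{1}{6}(3a+b-1)$. Then $$\sum_{\substack{m\in\mathbb{Z}\\ 3m^2+m\le 2n}} \left(m+\tfrac16\right)\, c\!\left(f;\, n-\tfrac32 m^2-\tfrac12 m\right) \;=\; \tfrac43\,\sigma(n)-\tfrac{16}{3}\,\sigma\!\left(\tfrac n2\right) - 2\sum_{\substack{a,b\in\mathbb{Z}\\ 2n=ab}} \mathrm{sgn}^+(N)\,\mathrm{sgn}^+(\tilde N)\,\Big(\left|N+\tfrac16\right|-\left|\tilde N+\tfrac16\right|\Big),$$ where the sum on the right hand side runs only over those pairs $(a,b)$ of (positive or negative) integers with $ab=2n$ for which both $N\in\mathbb{Z}$ and $\tilde N\in\mathbb{Z}$.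
   Context: $c(f;n)$ ($n\ge 0$ an integer) denotes the $n$-th coefficient of Ramanujan's third order mock theta function $$f(q)=\sum_{n=0}^\infty c(f;n)q^n := 1+\sum_{n=1}^\infty \frac{q^{n^2}}{(1+q)^2(1+q^2)^2\cdots(1+q^n)^2}.$$ $\sigma(n):=\sum_{0<d\mid n} d$ for a positive integer $n$, and $\sigma(n):=0$ if $n\notin\mathbb{Z}$. For an integer $n$, $\mathrm{sgn}^+(n):=\mathrm{sgn}(n)$ if $n\neq 0$ and $\mathrm{sgn}^+(0):=1$. *)

theory Defs
  imports "HOL-Analysis.Analysis" "HOL-Computational_Algebra.Computational_Algebra"
begin

(* The infinite sum is taken in the X-adic topology on formal power series; it converges by
   mock_f_summable below. *)
definition mock_f_term :: "nat \<Rightarrow> real fps" where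
  "mock_f_term n = fps_X ^ (n\<^sup>2) / (\<Prod>k=1..n. (1 + fps_X ^ k)\<^sup>2)"

definition mock_f :: "real fps" where
  "mock_f = 1 + (\<Sum>n. mock_f_term (Suc n))"

definition c_f :: "nat \<Rightarrow> real" where
  "c_f n = fps_nth mock_f n"

(* The argument is real, so that divisor_sigma (n / 2) makes sense and vanishes for odd n. *)
definition divisor_sigma :: "real \<Rightarrow> real" where
  "divisor_sigma x = (if x \<in> \<int> then (\<Sum>d | 0 < d \<and> d dvd \<lfloor>x\<rfloor>. real_of_int d) else 0)"

(* The theorem applies it only at integer values (those of N_of and N_tilde in the summation range). *)
definition sgn_plus :: "real \<Rightarrow> real" where
  "sgn_plus x = (if x = 0 then 1 else sgn x)"

definition N_of :: "int \<Rightarrow> int \<Rightarrow> real" where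
  "N_of a b = (1/6) * (- 3 * of_int a + of_int b - 1)"

definition N_tilde :: "int \<Rightarrow> int \<Rightarrow> real" where
  "N_tilde a b = (1/6) * (3 * of_int a + of_int b - 1)"

lemma mock_f_term_eq:
  "mock_f_term n = fps_X ^ (n\<^sup>2) * inverse (\<Prod>k=1..n. (1 + fps_X ^ k)\<^sup>2)"
proof -
  have "fps_nth (\<Prod>k=1..n. (1 + fps_X ^ k)\<^sup>2 :: real fps) 0 = 1"
    by (induction n) (simp_all add: power2_eq_square)
  then have "fps_nth (\<Prod>k=1..n. (1 + fps_X ^ k)\<^sup>2 :: real fps) 0 \<noteq> 0"
    by simp
  then show ?thesis
    unfolding mock_f_term_def by (rule fps_divide_unit)
qed

lemma mock_f_term_nth_eq_0:
  assumes "m < n\<^sup>2"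
  shows "fps_nth (mock_f_term n) m = 0"
  using assms by (simp add: mock_f_term_eq fps_X_power_mult_nth)

lemma mock_f_sums:
  "(\<lambda>n. mock_f_term (Suc n)) sums Abs_fps (\<lambda>m. \<Sum>n<m. fps_nth (mock_f_term (Suc n)) m)"
  unfolding sums_def
proof (rule tendsto_fpsI)
  fix m
  have "fps_nth (\<Sum>n<k. mock_f_term (Suc n)) m = (\<Sum>n<m. fps_nth (mock_f_term (Suc n)) m)"
    if "k \<ge> m" for k
  proof -
    have "fps_nth (mock_f_term (Suc n)) m = 0" if "n \<ge> m" for n
    proof (rule mock_f_term_nth_eq_0)
      have "m < Suc n" using that by simp
      also have "\<dots> \<le> (Suc n)\<^sup>2" by (simp add: power2_eq_square)
      finally show "m < (Suc n)\<^sup>2" .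
    qed
    then show ?thesis
      using that unfolding fps_sum_nth by (intro sum.mono_neutral_right) auto
  qed
  then show "\<forall>\<^sub>F k in sequentially. fps_nth (\<Sum>n<k. mock_f_term (Suc n)) m =
      fps_nth (Abs_fps (\<lambda>m. \<Sum>n<m. fps_nth (mock_f_term (Suc n)) m)) m"
    by (auto simp: eventually_sequentially)
qed

lemma mock_f_summable: "summable (\<lambda>n. mock_f_term (Suc n))"
  using mock_f_sums by (rule sums_summable)

lemma finite_left_index: "finite {m::int. 3 * m\<^sup>2 + m \<le> 2 * int n}"
proof (rule finite_subset)
  have "\<bar>m\<bar> \<le> 2 * int n" if "3 * m\<^sup>2 + m \<le> 2 * int n" for m
  proof -
    have "\<bar>m\<bar> \<le> m\<^sup>2"
    proof (cases "m = 0")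
      case False
      then have "\<bar>m\<bar> ^ 1 \<le> \<bar>m\<bar> ^ 2"
        by (intro power_increasing) auto
      then show ?thesis by simp
    qed simp
    then show ?thesis using that by linarith
  qed
  then show "{m. 3 * m\<^sup>2 + m \<le> 2 * int n} \<subseteq> {- (2 * int n)..2 * int n}"
    by fastforce
qed simp

lemma finite_right_index:
  assumes "n > 0"
  shows "finite {(a::int, b::int). 2 * int n = a * b \<and> N_of a b \<in> \<int> \<and> N_tilde a b \<in> \<int>}"
proof (rule finite_subset)
  show "{(a, b). 2 * int n = a * b \<and> N_of a b \<in> \<int> \<and> N_tilde a b \<in> \<int>}
      \<subseteq> {d. d dvd 2 * int n} \<times> {d. d dvd 2 * int n}"
    by auto
  show "finite ({d. d dvd 2 * int n} \<times> {d. d dvd 2 * int n})"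
    using assms by (intro finite_cartesian_product finite_divisors_int) auto
qed

(* Hence c_f (nat (int n - (3 * m^2 + m) div 2)) uses an exact division, and no truncation by nat
   occurs for 3 * m^2 + m <= 2 * n. *)
lemma pentagonal_index_exact:
  fixes m :: int
  assumes "3 * m\<^sup>2 + m \<le> 2 * int n"
  shows "real (nat (int n - (3 * m\<^sup>2 + m) div 2)) = real n - 3/2 * of_int m ^ 2 - 1/2 * of_int m"
proof -
  have "even (3 * m\<^sup>2 + m)"
    by simp
  then obtain j where j: "3 * m\<^sup>2 + m = 2 * j"
    by (elim evenE)
  have "real_of_int (3 * m\<^sup>2 + m) = real_of_int (2 * j)"
    by (simp only: j)
  then have "3 * real_of_int m ^ 2 + real_of_int m = 2 * real_of_int j"
    by simp
  moreover have "j \<le> int n"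
    using assms j by linarith
  moreover have "real (nat (int n - (3 * m\<^sup>2 + m) div 2)) = real n - of_int j"
    unfolding j using \<open>j \<le> int n\<close> by simp
  ultimately show ?thesis
    by linarith
qed

end

theory Submission
  imports Defs "HOL-Library.Groups_Big_Fun"
begin

text \<open>
  Everything takes place in formal power series in q. By Bailey's lemma, f(q) P(q) = S(q) with
  P(q) = sum of (-1)^r q^(r(3r-1)/2) and S(q) = sum of 2 (-1)^n q^(n(3n+1)/2) / (1 + q^n), both
  over all integers. Up to the factor 2, S is the value at x = -1 of the Appell--Lerch sum
  A(x) = sum of (-1)^n q^(n(3n+1)/2) / (1 - x q^n), which satisfies
  A(qx) + q x^3 A(x) = P (1 - q x^2). The theta function
  R(x) = sum of (-1)^m q^(m(3m+1)/2) (x^(3m+1) + x^(-3m)) satisfies R(qx) = - R(x) / (q x^3),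
  R(1) = 2 P and R(-1) = 0, and R'(-1) is the series theta(q) = sum of (6m+1) q^(m(3m+1)/2) that
  is convolved with the coefficients of f. Hence E = R A satisfies
  E(qx) - E(x) = P R(qx) (1 - q x^2), which determines its Laurent coefficients in the annulus
  |q| < |x| < 1 as multiples of P, with quotients that are Lambert-type series. Comparing the
  derivatives at x = -1 of both descriptions of E and cancelling P expresses theta f by Lambert
  series, whose coefficients are the divisor sums of the theorem. Since f only enters at x = -1,
  the variable x is never needed: Laurent series in x are represented by their coefficient
  families.
\<close>

subsection \<open>Locally finite sums of formal power series\<close>

text \<open>The factors are chosen to fit each other. The multipliers of R and A under x -> qx
  cancel in E, so each Laurent coefficient of E satisfies an equation of its own. Since R(-1) = 0,
  the derivative of E at -1 is R'(-1) A(-1): no derivative of A survives, and up to a factor 2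
  exactly \<open>theta * watson_series\<close> remains. The obstacle is that x = -1 lies on the
  boundary of the annulus, where the pole of A at x = 1 keeps the Laurent coefficients from tending
  to 0; multiplication by 1 - x removes it. The same pole explains the isolated constants in the
  recurrences: the expansions of 1/(1 - x) for |x| < 1 and for |x| > 1 differ by 1 in every
  coefficient, so comparing A(qx) with A(x) crosses the pole and shifts each coefficient of A by 1,
  and each coefficient of E by R(1) = 2 P. Since formal power series have no negative powers of q, a
  functional equation in x becomes a recurrence whose form depends on the sign of an exponent; this
  causes the case distinctions.\<close>

definition locally_finite :: "('i \<Rightarrow> 'a::comm_ring_1 fps) \<Rightarrow> bool" where
  "locally_finite F \<longleftrightarrow> (\<forall>N. finite {i. fps_nth (F i) N \<noteq> 0})"

text \<open>Junk value: the sum is only meaningful for locally finite families, since \<^const>\<open>Sum_any\<close>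
  returns 0 when infinitely many terms contribute to a coefficient.\<close>

definition fps_Sum :: "('i \<Rightarrow> 'a::comm_ring_1 fps) \<Rightarrow> 'a fps" where
  "fps_Sum F = Abs_fps (\<lambda>N. Sum_any (\<lambda>i. fps_nth (F i) N))"

lemma locally_finiteI:
  "(\<And>N. finite {i. fps_nth (F i) N \<noteq> 0}) \<Longrightarrow> locally_finite F"
  by (simp add: locally_finite_def)

lemma locally_finiteD: "locally_finite F \<Longrightarrow> finite {i. fps_nth (F i) N \<noteq> 0}"
  by (simp add: locally_finite_def)

text \<open>Coefficient N of a product involves only the coefficients up to N of each factor, so
  this is the index set on which the arguments about products rest.\<close>

lemma finite_low_coeffs:
  assumes "locally_finite F"
  shows "finite {i. \<exists>n\<le>N. fps_nth (F i) n \<noteq> 0}"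
proof -
  have "{i. \<exists>n\<le>N. fps_nth (F i) n \<noteq> 0} = (\<Union>n\<le>N. {i. fps_nth (F i) n
      \<noteq> 0})"
    by auto
  with locally_finiteD[OF assms] show ?thesis by simp
qed

lemma fps_Sum_nth:
  assumes "finite A" and "\<And>i. i \<notin> A \<Longrightarrow> fps_nth (F i) N = 0"
  shows "fps_nth (fps_Sum F) N = (\<Sum>i\<in>A. fps_nth (F i) N)"
proof -
  have "{i. fps_nth (F i) N \<noteq> 0} \<subseteq> A" using assms(2) by blast
  with assms(1) show ?thesis
    unfolding fps_Sum_def by (simp add: Sum_any.expand_superset)
qed

lemma fps_Sum_eq_sum:
  assumes "finite A" and "\<And>i. i \<notin> A \<Longrightarrow> F i = 0"
  shows "fps_Sum F = (\<Sum>i\<in>A. F i)"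
  by (rule fps_ext) (subst fps_Sum_nth[OF assms(1)], use assms(2) in \<open>auto simp: fps_sum_nth\<close>)

lemma fps_Sum_cong: "(\<And>i. F i = G i) \<Longrightarrow> fps_Sum F = fps_Sum G"
  by (simp add: fps_Sum_def)

lemma locally_finite_mult:
  assumes "locally_finite F"
  shows "locally_finite (\<lambda>i. F i * c i)" "locally_finite (\<lambda>i. c i * F i)"
proof -
  show *: "locally_finite (\<lambda>i. F i * c i)"
  proof (rule locally_finiteI, rule finite_subset[OF _ finite_low_coeffs[OF assms]])
    show "{i. fps_nth (F i * c i) N \<noteq> 0} \<subseteq> {i. \<exists>n\<le>N. fps_nth (F i) n
        \<noteq> 0}" for N
      unfolding fps_mult_nth by (fastforce elim!: sum.not_neutral_contains_not_neutral)
  qed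
  then show "locally_finite (\<lambda>i. c i * F i)"
    by (simp add: mult.commute)
qed

lemma locally_finite_add:
  assumes "locally_finite F" "locally_finite G"
  shows "locally_finite (\<lambda>i. F i + G i)"
proof (rule locally_finiteI)
  fix N
  show "finite {i. fps_nth (F i + G i) N \<noteq> 0}"
    by (rule finite_subset[OF _ finite_UnI[OF locally_finiteD[OF assms(1), of N]
        locally_finiteD[OF assms(2), of N]]]) auto
qed

lemma locally_finite_uminus: "locally_finite F \<Longrightarrow> locally_finite (\<lambda>i. - F i)"
  by (simp add: locally_finite_def)

lemma locally_finite_diff:
  assumes "locally_finite F" "locally_finite G"
  shows "locally_finite (\<lambda>i. F i - G i)"
  using locally_finite_add[OF assms(1) locally_finite_uminus[OF assms(2)]] by simp

lemma locally_finite_inj: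
  assumes "locally_finite F" "inj h"
  shows "locally_finite (\<lambda>i. F (h i))"
proof (rule locally_finiteI)
  fix N
  have "finite (h -` {i. fps_nth (F i) N \<noteq> 0})"
    by (rule finite_vimageI[OF locally_finiteD[OF assms(1)] assms(2)])
  then show "finite {i. fps_nth (F (h i)) N \<noteq> 0}" by (simp add: vimage_def)
qed

lemma locally_finite_finite:
  assumes "finite A" and "\<And>i. i \<notin> A \<Longrightarrow> F i = 0"
  shows "locally_finite F"
  by (rule locally_finiteI, rule finite_subset[OF _ assms(1)]) (use assms(2) in force)

lemma locally_finite_X_power:
  assumes "\<And>N. finite {i. d i \<le> (N::nat)}"
  shows "locally_finite (\<lambda>i. c i * fps_X ^ d i)"
proof (rule locally_finiteI, rule finite_subset[OF _ assms])
  show "{i. fps_nth (c i * fps_X ^ d i) N \<noteq> 0} \<subseteq> {i. d i \<le> N}" for N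
    by (auto simp: fps_X_power_mult_right_nth split: if_splits)
qed

lemma fps_Sum_add:
  assumes "locally_finite F" "locally_finite G"
  shows "fps_Sum (\<lambda>i. F i + G i) = fps_Sum F + fps_Sum G"
  by (rule fps_ext) (simp add: fps_Sum_def Sum_any.distrib locally_finiteD assms)

lemma fps_Sum_mult_left:
  assumes "locally_finite F"
  shows "fps_Sum (\<lambda>i. c * F i) = c * fps_Sum F"
proof (rule fps_ext)
  fix N
  let ?A = "{i. \<exists>n\<le>N. fps_nth (F i) n \<noteq> 0}"
  have fin: "finite ?A" by (rule finite_low_coeffs[OF assms])
  have "fps_nth (fps_Sum (\<lambda>i. c * F i)) N = (\<Sum>i\<in>?A. fps_nth (c * F i) N)"
    by (rule fps_Sum_nth[OF fin]) (auto simp: fps_mult_nth intro!: sum.neutral)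
  also have "\<dots> = (\<Sum>n=0..N. fps_nth c n * (\<Sum>i\<in>?A. fps_nth (F i) (N - n)))"
    unfolding fps_mult_nth sum_distrib_left by (rule sum.swap)
  also have "\<dots> = (\<Sum>n=0..N. fps_nth c n * fps_nth (fps_Sum F) (N - n))"
    by (intro sum.cong refl arg_cong2[where f = "(*)"] fps_Sum_nth[OF fin, symmetric]) auto
  finally show "fps_nth (fps_Sum (\<lambda>i. c * F i)) N = fps_nth (c * fps_Sum F) N"
    by (simp add: fps_mult_nth)
qed

lemma fps_Sum_mult_right:
  "locally_finite F \<Longrightarrow> fps_Sum (\<lambda>i. F i * c) = fps_Sum F * c"
  using fps_Sum_mult_left[of F c] by (simp add: mult.commute)

lemma fps_Sum_uminus:
  assumes "locally_finite F"
  shows "fps_Sum (\<lambda>i. - F i) = - fps_Sum F"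
  using fps_Sum_mult_left[OF assms, of "-1"] by simp

lemma fps_Sum_diff:
  assumes "locally_finite F" "locally_finite G"
  shows "fps_Sum (\<lambda>i. F i - G i) = fps_Sum F - fps_Sum G"
  using fps_Sum_add[OF assms(1) locally_finite_uminus[OF assms(2)]] fps_Sum_uminus[OF assms(2)]
  by simp

lemma fps_Sum_reindex:
  assumes "bij h"
  shows "fps_Sum (\<lambda>i. F (h i)) = fps_Sum F"
  unfolding fps_Sum_def
  by (intro arg_cong[where f = Abs_fps] ext Sum_any.reindex_cong[OF assms, symmetric]) auto

lemma fps_Sum_inj:
  assumes "locally_finite F" "inj h" and "\<And>j. j \<notin> range h \<Longrightarrow> F j = 0"
  shows "fps_Sum (\<lambda>i. F (h i)) = fps_Sum F"
proof (rule fps_ext)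
  fix N
  let ?B = "{j. fps_nth (F j) N \<noteq> 0}" and ?A = "{i. fps_nth (F (h i)) N \<noteq> 0}"
  have B: "?B = h ` ?A" using assms(3) by force
  have "fps_nth (fps_Sum F) N = (\<Sum>j\<in>h ` ?A. fps_nth (F j) N)"
    unfolding B[symmetric] by (rule fps_Sum_nth[OF locally_finiteD[OF assms(1)]]) auto
  also have "\<dots> = (\<Sum>i\<in>?A. fps_nth (F (h i)) N)"
    by (simp add: sum.reindex[OF inj_on_subset[OF assms(2) subset_UNIV]])
  also have "\<dots> = fps_nth (fps_Sum (\<lambda>i. F (h i))) N"
    by (rule fps_Sum_nth[symmetric], rule locally_finiteD[OF locally_finite_inj[OF assms(1,2)]]) auto
  finally show "fps_nth (fps_Sum (\<lambda>i. F (h i))) N = fps_nth (fps_Sum F) N" ..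
qed

text \<open>Fubini: for each coefficient the contributing pairs lie in the finite rectangle spanned
  by the projections of the support, and both sides become sums over it.\<close>

lemma fps_Sum_curry:
  assumes "locally_finite (\<lambda>(i, j). F i j)"
  shows "locally_finite (\<lambda>i. fps_Sum (F i))"
    and "fps_Sum (\<lambda>i. fps_Sum (F i)) = fps_Sum (\<lambda>(i, j). F i j)"
proof -
  let ?S = "\<lambda>N. {p. fps_nth (case p of (i, j) \<Rightarrow> F i j) N \<noteq> 0}"
  have fin: "finite (?S N)" for N by (rule locally_finiteD[OF assms])
  have inner: "fps_nth (fps_Sum (F i)) N = (\<Sum>j\<in>snd ` ?S N. fps_nth (F i j) N)" for i N
    by (rule fps_Sum_nth[OF finite_imageI[OF fin]]) (auto simp: image_iff)
  have outside: "fps_nth (fps_Sum (F i)) N = 0" if "i \<notin> fst ` ?S N" for i N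
    unfolding inner using that by (intro sum.neutral ballI) (auto simp: image_iff)
  show "locally_finite (\<lambda>i. fps_Sum (F i))"
    by (rule locally_finiteI, rule finite_subset[OF _ finite_imageI[OF fin]]) (use outside in blast)
  show "fps_Sum (\<lambda>i. fps_Sum (F i)) = fps_Sum (\<lambda>(i, j). F i j)"
  proof (rule fps_ext)
    fix N
    have "fps_nth (fps_Sum (\<lambda>i. fps_Sum (F i))) N
        = (\<Sum>i\<in>fst ` ?S N. fps_nth (fps_Sum (F i)) N)"
      by (rule fps_Sum_nth) (use fin outside in auto)
    also have "\<dots> = (\<Sum>(i, j)\<in>fst ` ?S N \<times> snd ` ?S N. fps_nth (F i j) N)"
      by (simp add: inner sum.cartesian_product)
    also have "\<dots> = fps_nth (fps_Sum (\<lambda>(i, j). F i j)) N"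
      by (subst fps_Sum_nth[of "fst ` ?S N \<times> snd ` ?S N"])
        (auto simp: image_iff split_def fin[unfolded split_def])
    finally show "fps_nth (fps_Sum (\<lambda>i. fps_Sum (F i))) N
        = fps_nth (fps_Sum (\<lambda>(i, j). F i j)) N" .
  qed
qed

lemma locally_finite_swap:
  assumes "locally_finite (\<lambda>(i, j). F i j)"
  shows "locally_finite (\<lambda>(j, i). F i j)"
  using locally_finite_inj[OF assms, of prod.swap] by (simp add: split_def)

lemma fps_Sum_swap:
  assumes "locally_finite (\<lambda>(i, j). F i j)"
  shows "fps_Sum (\<lambda>i. fps_Sum (\<lambda>j. F i j)) = fps_Sum (\<lambda>j. fps_Sum (\<lambda>i. F
      i j))"
proof -
  have "fps_Sum (\<lambda>j. fps_Sum (\<lambda>i. F i j)) = fps_Sum (\<lambda>(j, i). F i j)"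
    by (rule fps_Sum_curry(2)[OF locally_finite_swap[OF assms]])
  also have "\<dots> = fps_Sum (\<lambda>(i, j). F i j)"
    using fps_Sum_reindex[OF bij_swap, of "\<lambda>(i, j). F i j"] by (simp add: split_def)
  finally show ?thesis by (simp add: fps_Sum_curry(2)[OF assms])
qed

lemma locally_finite_product:
  assumes "locally_finite F" "locally_finite G"
  shows "locally_finite (\<lambda>(i, j). F i * G j)"
proof (rule locally_finiteI)
  fix N
  let ?A = "{i. \<exists>n\<le>N. fps_nth (F i) n \<noteq> 0}" and ?B = "{i. \<exists>n\<le>N. fps_nth
      (G i) n \<noteq> 0}"
  have "i \<in> ?A \<and> j \<in> ?B" if "fps_nth (F i * G j) N \<noteq> 0" for i j
  proof -
    from that obtain n where "n \<le> N" "fps_nth (F i) n * fps_nth (G j) (N - n) \<noteq> 0"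
      unfolding fps_mult_nth by (auto elim!: sum.not_neutral_contains_not_neutral)
    moreover from this have "fps_nth (F i) n \<noteq> 0" "fps_nth (G j) (N - n) \<noteq> 0" by auto
    ultimately show ?thesis by (auto intro: exI[of _ n] exI[of _ "N - n"])
  qed
  then have "{p. fps_nth (case p of (i, j) \<Rightarrow> F i * G j) N \<noteq> 0} \<subseteq> ?A
      \<times> ?B" by auto
  then show "finite {p. fps_nth (case p of (i, j) \<Rightarrow> F i * G j) N \<noteq> 0}"
    by (rule finite_subset) (intro finite_cartesian_product finite_low_coeffs assms)
qed

lemma fps_Sum_product:
  assumes "locally_finite F" "locally_finite G"
  shows "fps_Sum F * fps_Sum G = fps_Sum (\<lambda>(i, j). F i * G j)"
proof -
  have "fps_Sum (\<lambda>(i, j). F i * G j) = fps_Sum (\<lambda>i. fps_Sum (\<lambda>j. F i * G j))"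
    by (rule fps_Sum_curry(2)[OF locally_finite_product[OF assms], symmetric])
  also have "\<dots> = fps_Sum F * fps_Sum G"
    by (simp add: fps_Sum_mult_left fps_Sum_mult_right assms)
  finally show ?thesis ..
qed

lemma fps_Sum_nat_Suc:
  assumes "locally_finite F"
  shows "fps_Sum F = F 0 + fps_Sum (\<lambda>n. F (Suc n))"
proof -
  let ?d = "\<lambda>n::nat. if n = 0 then F 0 else 0" and ?G = "\<lambda>n::nat. if n = 0 then 0 else F n"
  have d: "locally_finite ?d" by (rule locally_finite_finite[of "{0}"]) auto
  have G: "locally_finite ?G"
    using locally_finite_diff[OF assms d] by (rule back_subst[of locally_finite]) auto
  have "fps_Sum F = fps_Sum (\<lambda>n. ?d n + ?G n)" by (rule fps_Sum_cong) simp
  also have "\<dots> = fps_Sum ?d + fps_Sum ?G" by (rule fps_Sum_add[OF d G])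
  also have "fps_Sum ?d = F 0" by (subst fps_Sum_eq_sum[of "{0}"]) auto
  also have "fps_Sum ?G = fps_Sum (\<lambda>n. ?G (Suc n))"
    by (rule fps_Sum_inj[OF G, symmetric]) (auto simp: image_iff gr0_conv_Suc)
  finally show ?thesis by simp
qed

lemma fps_Sum_int_split:
  assumes "locally_finite F"
  shows "fps_Sum F = fps_Sum (\<lambda>n. F (int n)) + fps_Sum (\<lambda>n. F (- 1 - int n))"
proof -
  let ?p = "\<lambda>k. if k \<ge> 0 then F k else 0" and ?m = "\<lambda>k. if k \<ge> 0 then 0 else F k"
  have p: "locally_finite ?p"
    using locally_finite_mult(1)[OF assms, of "\<lambda>k. if k \<ge> 0 then 1 else 0"]
    by (rule back_subst[of locally_finite]) auto
  have m: "locally_finite ?m"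
    using locally_finite_diff[OF assms p] by (rule back_subst[of locally_finite]) auto
  have "fps_Sum F = fps_Sum (\<lambda>k. ?p k + ?m k)" by (rule fps_Sum_cong) simp
  also have "\<dots> = fps_Sum ?p + fps_Sum ?m" by (rule fps_Sum_add[OF p m])
  also have "fps_Sum ?p = fps_Sum (\<lambda>n. ?p (int n))"
  proof (rule fps_Sum_inj[OF p, symmetric])
    show "?p j = 0" if "j \<notin> range int" for j
      using that rangeI[of int "nat j"] by force
  qed simp
  also have "fps_Sum ?m = fps_Sum (\<lambda>n. ?m (- 1 - int n))"
  proof (rule fps_Sum_inj[OF m, symmetric])
    show "?m j = 0" if "j \<notin> range (\<lambda>n. - 1 - int n)" for j
      using that rangeI[of "\<lambda>n. - 1 - int n" "nat (- 1 - j)"] by (auto split: if_splits)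
  qed (simp add: inj_def)
  finally show ?thesis by simp
qed

subsection \<open>The Appell--Lerch form of the mock theta function\<close>

definition alt :: "int \<Rightarrow> real fps" where
  "alt k = (if even k then 1 else - 1)"

lemma alt_simps [simp]:
  "alt 0 = 1"
  "alt (k + 1) = - alt k"
  "alt (1 + k) = - alt k"
  "alt (1 - k) = - alt k"
  "alt (- k) = alt k"
  "alt k * alt k = 1"
  by (auto simp: alt_def)

section \<open>Reciprocal q-factorials and Bailey pairs\<close>

definition inv_qfact :: "int \<Rightarrow> real fps" where
  "inv_qfact z = (if z < 0 then 0 else inverse (\<Prod>k=1..nat z. 1 - fps_X ^ k))"

lemma inv_qfact_neg [simp]: "z < 0 \<Longrightarrow> inv_qfact z = 0"
  by (simp add: inv_qfact_def)

lemma inv_qfact_0 [simp]: "inv_qfact 0 = 1"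
  by (simp add: inv_qfact_def)

text \<open>The value 0 at negative arguments makes the recurrence valid for every integer: at z = 0
  the factor 1 - q^0 vanishes, and for z < 0 both sides are 0. Sums over r thus need no boundary
  terms.\<close>

lemma inv_qfact_rec: "inv_qfact (z - 1) = (1 - fps_X ^ nat z) * inv_qfact z"
proof (cases "z \<ge> 1")
  case True
  then obtain m where m': "z = int (Suc m)"
    by (metis Suc_diff_1 int_nat_eq int_one_le_iff_zero_less less_le_not_le zero_less_nat_eq)
  have m: "nat z = Suc m" "nat (z - 1) = m" "z > 0" using m' by simp_all
  define p where "p = (\<Prod>k=1..m. 1 - fps_X ^ k :: real fps)"
  have 1: "inv_qfact z = inverse (p * (1 - fps_X ^ Suc m))" and 2: "inv_qfact (z - 1) = inverse p"
    unfolding inv_qfact_def p_def using m by simp_all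
  have "(1 - fps_X ^ Suc m) * inverse (1 - fps_X ^ Suc m :: real fps) = 1"
    by (rule inverse_mult_eq_1') simp
  then show ?thesis
    unfolding 1 2 m by (simp add: fps_inverse_mult mult_ac)
next
  case False
  then show ?thesis by (cases "z = 0") auto
qed

lemma bij_int_reflect: "bij (\<lambda>i. c - i :: int)"
  by (rule involuntory_imp_bij) simp

lemma bij_int_shift: "bij (\<lambda>i. i + c :: int)"
  by (rule o_bij[of "\<lambda>i. i - c"]) auto

lemma le_of_mult_self_le: "s * s \<le> N \<Longrightarrow> s \<le> (N::nat)"
  using le_square[of s] by linarith

definition tri :: "int \<Rightarrow> nat" where
  "tri r = nat (r * (r - 1) div 2)"

lemma tri_nonneg: "0 \<le> r * (r - 1) div (2::int)"
  by (cases "r \<ge> 1") (auto simp: zero_le_mult_iff mult_nonpos_nonpos)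

lemma int_tri: "2 * int (tri r) = r * (r - 1)"
  using tri_nonneg[of r] unfolding tri_def by simp

lemma tri_reflect: "tri (1 - r) = tri r"
  by (simp add: tri_def algebra_simps)

lemma tri_Suc: "int (tri (r + 1)) = int (tri r) + r"
proof -
  have "2 * int (tri (r + 1)) = 2 * int (tri r) + 2 * r"
    unfolding int_tri by (simp add: algebra_simps)
  then show ?thesis by simp
qed

context
  fixes n :: nat
begin

text \<open>The kernel 1/((q)_(n-r) (q)_(n+r)) of Bailey pairs with a = 1; up to the factor (q)_(2n)
  it is a central q-binomial coefficient.\<close>

definition "qbin r = inv_qfact (int n - r) * inv_qfact (int n + r)"

lemma qbin_outside: "\<bar>r\<bar> > int n \<Longrightarrow> qbin r = 0"
  by (auto simp: qbin_def abs_if split: if_splits)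

lemma locally_finite_qbin: "locally_finite (\<lambda>r. c r * qbin r)"
  by (rule locally_finite_finite[of "{- int n..int n}"]) (auto simp: qbin_outside not_le abs_if)

text \<open>The summand \<open>h\<close> has n + r - 1 where \<open>qbin\<close> has n + r. This
  makes it antisymmetric under r -> 1 - r, so its sum is 0. Rewriting \<open>h r\<close> and
  \<open>h (r + 1)\<close> through \<open>qbin\<close> gives the two relations.\<close>

lemma sum_qbin_reflect:
  "fps_Sum (\<lambda>r. alt r * fps_X ^ tri r * qbin r)
    = fps_X ^ n * fps_Sum (\<lambda>r. alt r * fps_X ^ tri (r + 1) * qbin r)"
  "fps_Sum (\<lambda>r. alt r * fps_X ^ tri (r + 1) * qbin r)
    = fps_X ^ n * fps_Sum (\<lambda>r. alt r * fps_X ^ tri r * qbin r)"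
proof -
  define h where "h r = alt r * fps_X ^ tri r * (inv_qfact (int n - r) * inv_qfact (int n + r - 1))" for r
  have h1: "h r = alt r * fps_X ^ tri r * qbin r - fps_X ^ n * (alt r * fps_X ^ tri (r + 1) * qbin r)" for r
  \<comment> \<open>Outside |r| <= n the function \<open>nat\<close> may truncate and spoil the
    identity of exponents, but there both sides are 0.\<close>
  proof (cases "\<bar>r\<bar> > int n")
    case False
    then have "tri r + nat (int n + r) = n + tri (r + 1)"
      using tri_Suc[of r] by linarith
    then have "fps_X ^ tri r * fps_X ^ nat (int n + r) = (fps_X ^ n * fps_X ^ tri (r + 1) :: real fps)"
      by (metis power_add)
    moreover have "h r = alt r * fps_X ^ tri r * qbin r - alt r * (fps_X ^ tri r * fps_X ^ nat (int n +
        r)) * qbin r"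
      unfolding h_def qbin_def inv_qfact_rec by (simp add: algebra_simps)
    ultimately show ?thesis by (simp add: mult_ac)
  qed (auto simp: h_def qbin_outside abs_if split: if_splits)
  have h2: "h (r + 1) = fps_X ^ n * (alt r * fps_X ^ tri r * qbin r) - alt r * fps_X ^ tri (r + 1) *
      qbin r" for r
  proof (cases "\<bar>r\<bar> > int n")
    case False
    then have "tri (r + 1) + nat (int n - r) = n + tri r"
      using tri_Suc[of r] by linarith
    then have *: "fps_X ^ tri (r + 1) * fps_X ^ nat (int n - r) = (fps_X ^ n * fps_X ^ tri r :: real fps)"
      by (metis power_add)
    have "inv_qfact (int n - (r + 1)) = (1 - fps_X ^ nat (int n - r)) * inv_qfact (int n - r)"
      using inv_qfact_rec[of "int n - r"] by (simp add: algebra_simps)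
    then have "h (r + 1) = - alt r * fps_X ^ tri (r + 1) * ((1 - fps_X ^ nat (int n - r)) * inv_qfact
        (int n - r) * inv_qfact (int n + r))"
      by (simp add: h_def)
    then have "h (r + 1) = alt r * (fps_X ^ tri (r + 1) * fps_X ^ nat (int n - r)) * qbin r
        - alt r * fps_X ^ tri (r + 1) * qbin r"
      by (simp add: qbin_def algebra_simps)
    then show ?thesis by (simp add: * mult_ac)
  qed (auto simp: h_def qbin_outside abs_if split: if_splits)
  have lf: "locally_finite h"
    unfolding h1 by (intro locally_finite_diff locally_finite_mult locally_finite_qbin)
  have "h (1 - r) = - h r" for r
    by (simp add: h_def tri_reflect algebra_simps)
  then have "fps_Sum (\<lambda>r. h (1 - r)) = - fps_Sum h"
    by (simp add: fps_Sum_uminus[OF lf])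
  then have "fps_Sum h = - fps_Sum h"
    using fps_Sum_reindex[OF bij_int_reflect, of h 1] by simp
  then have 0: "fps_Sum h = 0"
    by (simp add: eq_neg_iff_add_eq_0 flip: mult_2)
  show "fps_Sum (\<lambda>r. alt r * fps_X ^ tri r * qbin r)
    = fps_X ^ n * fps_Sum (\<lambda>r. alt r * fps_X ^ tri (r + 1) * qbin r)"
    using 0 unfolding h1
    by (simp add: fps_Sum_diff fps_Sum_mult_left locally_finite_qbin locally_finite_mult)
  have "fps_Sum (\<lambda>r. h (r + 1)) = 0"
    using fps_Sum_reindex[OF bij_int_shift, of h 1] 0 by simp
  then show "fps_Sum (\<lambda>r. alt r * fps_X ^ tri (r + 1) * qbin r)
    = fps_X ^ n * fps_Sum (\<lambda>r. alt r * fps_X ^ tri r * qbin r)"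
    unfolding h2
    by (simp add: fps_Sum_diff fps_Sum_mult_left locally_finite_qbin locally_finite_mult)
qed

text \<open>Both reflections in turn multiply the sum by q^(2n), and 1 - q^(2n) is nonzero for n >
  0. Together with the value 1 at n = 0 this is the unit Bailey pair.\<close>

lemma sum_qbin_alternating:
  assumes "n > 0"
  shows "fps_Sum (\<lambda>r. alt r * fps_X ^ tri r * qbin r) = 0" (is "?s = 0")
    and "fps_Sum (\<lambda>r. alt r * fps_X ^ tri (r + 1) * qbin r) = 0"
proof -
  have "?s = fps_X ^ n * (fps_X ^ n * ?s)"
    using sum_qbin_reflect by metis
  then have "(1 - fps_X ^ n * fps_X ^ n) * ?s = 0"
    by (simp add: algebra_simps)
  moreover have "fps_nth (1 - fps_X ^ n * fps_X ^ n :: real fps) 0 \<noteq> 0"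
    using assms by simp
  then have "1 - fps_X ^ n * fps_X ^ n \<noteq> (0 :: real fps)" by force
  ultimately show "?s = 0" by simp
  then show "fps_Sum (\<lambda>r. alt r * fps_X ^ tri (r + 1) * qbin r) = 0"
    using sum_qbin_reflect(2) by simp
qed

end

text \<open>The terms of S at r and -r agree, which permits |r| and keeps exponents natural. The
  factor q^(r^2) is left out because Bailey's lemma supplies it: r(r+1)/2 + r^2 = r(3r+1)/2. The
  value at r = 0 is 1, as the denominator there is 2.\<close>

definition watson_coeff :: "int \<Rightarrow> real fps" where
  "watson_coeff r = 2 * alt r * fps_X ^ tri (\<bar>r\<bar> + 1) * inverse (1 + fps_X ^ nat \<bar>r\<bar>)"

lemma watson_coeff_mult: "watson_coeff r * (1 + fps_X ^ nat \<bar>r\<bar>) = 2 * alt r * fps_X ^ tri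
    (\<bar>r\<bar> + 1)"
proof -
  have "inverse (1 + fps_X ^ nat \<bar>r\<bar>) * (1 + fps_X ^ nat \<bar>r\<bar> :: real fps) = 1"
    by (rule inverse_mult_eq_1) simp
  then show ?thesis by (simp add: watson_coeff_def mult.assoc)
qed

text \<open>With m = n + 1, y = q^|r| and z = q^(m - |r|) the left side contains (1 + yz)^2 - (1 -
  z)(1 - y^2 z) = z (1 + y)^2. One factor 1 + y cancels the denominator of
  \<open>watson_coeff\<close>, the other produces the two neighbouring triangular exponents.\<close>

lemma watson_coeff_qbin_rec:
  "(1 + fps_X ^ Suc n)\<^sup>2 * (watson_coeff r * qbin (Suc n) r) - watson_coeff r * qbin n r
    = 2 * fps_X ^ Suc n * (alt r * fps_X ^ tri r * qbin (Suc n) r + alt r * fps_X ^ tri (r + 1) * qbin (Suc n) r)"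
proof (cases "\<bar>r\<bar> > int (Suc n)")
  case False
  define m s where "m = Suc n" and "s = nat \<bar>r\<bar>"
  have "s \<le> m" using False by (simp add: m_def s_def)
  have n: "qbin n r = (1 - fps_X ^ (m - s)) * (1 - fps_X ^ (m + s)) * qbin m r"
  proof -
    have "inv_qfact (int n - r) = (1 - fps_X ^ nat (int m - r)) * inv_qfact (int m - r)"
      "inv_qfact (int n + r) = (1 - fps_X ^ nat (int m + r)) * inv_qfact (int m + r)"
      using inv_qfact_rec[of "int m - r"] inv_qfact_rec[of "int m + r"] by (simp_all add: m_def algebra_simps)
    moreover have "(1 - fps_X ^ nat (int m - r)) * (1 - fps_X ^ nat (int m + r)) = (1 - fps_X ^ (m - s))
        * (1 - fps_X ^ (m + s) :: real fps)"
    proof (cases "r \<ge> 0")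
      case True
      then have "nat (int m - r) = m - s" "nat (int m + r) = m + s" by (simp_all add: s_def)
      then show ?thesis by simp
    next
      case F: False
      then have "nat (int m + r) = m - s" "nat (int m - r) = m +
          s" using \<open>s \<le> m\<close> by (simp_all add: s_def)
      then show ?thesis by (simp add: mult.commute)
    qed
    ultimately show ?thesis by (simp add: qbin_def mult_ac)
  qed
  have tri2: "fps_X ^ tri r + fps_X ^ tri (r + 1) = (fps_X ^ tri (int s) + fps_X ^ tri (int s + 1) ::
      real fps)"
  proof (cases "r \<ge> 0")
    case False
    have "tri r = tri (int s + 1)" "tri (r + 1) = tri (int s)"
      using False tri_reflect[of r] tri_reflect[of "r + 1"] by (simp_all add: s_def)
    then show ?thesis by (simp add: add.commute)
  qed (simp add: s_def)
  have T: "tri (int s + 1) = tri (int s) + s" using tri_Suc[of "int s"] by linarith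
  have a: "watson_coeff r * (1 + fps_X ^ s) = 2 * alt r * (fps_X ^ tri (int s) * fps_X ^ s)"
    using watson_coeff_mult[of r] T by (simp add: s_def power_add)
  define y z where "y = (fps_X ^ s :: real fps)" and "z = (fps_X ^ (m - s) :: real fps)"
  have m: "fps_X ^ m = y * z" "fps_X ^ (m + s) = y * z * y"
    using \<open>s \<le> m\<close> by (simp_all add: y_def z_def flip: power_add)
  have "(1 + y * z)\<^sup>2 * watson_coeff r - watson_coeff r * ((1 - z) * (1 - y * z * y)) =
      watson_coeff r * (1 + y) * (z * (1 + y))"
    by (simp add: power2_eq_square algebra_simps)
  also have "\<dots> = 2 * (y * z) * (alt r * (fps_X ^ tri (int s) + fps_X ^ tri (int s + 1)))"
    unfolding T power_add using a unfolding y_def[symmetric] by (simp add: algebra_simps)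
  finally have *: "(1 + y * z)\<^sup>2 * watson_coeff r - watson_coeff r * ((1 - z) * (1 - y * z * y))
    = 2 * (y * z) * (alt r * (fps_X ^ tri r + fps_X ^ tri (r + 1)))" unfolding tri2 .
  have "(1 + y * z)\<^sup>2 * (watson_coeff r * qbin m r) - watson_coeff r * ((1 - z) * (1 - y * z * y)
      * qbin m r)
    = ((1 + y * z)\<^sup>2 * watson_coeff r - watson_coeff r * ((1 - z) * (1 - y * z * y))) * qbin m r"
    by (simp only: left_diff_distrib mult.assoc)
  also have "\<dots> = 2 * (y * z) * (alt r * fps_X ^ tri r * qbin m r + alt r * fps_X ^ tri (r + 1) *
      qbin m r)"
    unfolding * by (simp only: distrib_left distrib_right mult.assoc)
  finally show ?thesis
    unfolding m_def[symmetric] n m z_def[symmetric] .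
qed (auto simp: qbin_outside)

text \<open>\<open>watson_coeff\<close> and the reciprocal of this product form a Bailey pair: the
  error in passing from n to n + 1 is a combination of the two alternating sums, which
  vanish.\<close>

lemma sum_watson_coeff_qbin:
  "fps_Sum (\<lambda>r. watson_coeff r * qbin n r) * (\<Prod>k=1..n. (1 + fps_X ^ k)\<^sup>2) = 1"
proof (induction n)
  case 0
  have "fps_Sum (\<lambda>r. watson_coeff r * qbin 0 r) = (\<Sum>r\<in>{0}. watson_coeff r * qbin 0 r)"
    by (rule fps_Sum_eq_sum) (auto simp: qbin_outside)
  also have "\<dots> = 1"
    using watson_coeff_mult[of 0] by (simp add: qbin_def tri_def)
  finally show ?case by simp
next
  case (Suc n)
  have "(1 + fps_X ^ Suc n)\<^sup>2 * fps_Sum (\<lambda>r. watson_coeff r * qbin (Suc n) r) - fps_Sum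
      (\<lambda>r. watson_coeff r * qbin n r)
    = fps_Sum (\<lambda>r. (1 + fps_X ^ Suc n)\<^sup>2 * (watson_coeff r * qbin (Suc n) r) - watson_coeff r * qbin n r)"
    by (simp add: fps_Sum_diff fps_Sum_mult_left locally_finite_qbin locally_finite_mult)
  also have "\<dots> = 2 * fps_X ^ Suc n * (fps_Sum (\<lambda>r. alt r * fps_X ^ tri r * qbin (Suc n) r)
      + fps_Sum (\<lambda>r. alt r * fps_X ^ tri (r + 1) * qbin (Suc n) r))"
    unfolding watson_coeff_qbin_rec
    by (simp add: fps_Sum_add fps_Sum_mult_left locally_finite_qbin locally_finite_mult locally_finite_add)
  also have "\<dots> = 0" by (simp add: sum_qbin_alternating)
  finally have *: "fps_Sum (\<lambda>r. watson_coeff r * qbin n r)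
      = (1 + fps_X ^ Suc n)\<^sup>2 * fps_Sum (\<lambda>r. watson_coeff r * qbin (Suc n) r)" by simp
  show ?case using Suc unfolding * by (simp add: mult_ac)
qed

section \<open>Durfee sums and Bailey's lemma\<close>

definition durfee :: "nat \<Rightarrow> real fps" where
  "durfee k = fps_Sum (\<lambda>s. fps_X ^ (s * (s + k)) * (inv_qfact (int s) * inv_qfact (int (s + k))))"

lemma locally_finite_durfee: "locally_finite (\<lambda>s. fps_X ^ (s * (s + k)) * c s)"
proof -
  have "{s. s * (s + k) \<le> N} \<subseteq> {..N}" for N
  proof
    fix s assume "s \<in> {s. s * (s + k) \<le> N}"
    then have "s * s \<le> N" by (simp add: algebra_simps)
    then show "s \<in> {..N}" by (auto dest: le_of_mult_self_le)
  qed
  then have "finite {s. s * (s + k) \<le> N}" for N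
    using finite_subset by blast
  from locally_finite_X_power[OF this, of c] show ?thesis by (simp add: mult.commute)
qed

lemma inv_qfact_nat_rec: "inv_qfact (int n) = (1 - fps_X ^ Suc n) * inv_qfact (int (Suc n))"
  using inv_qfact_rec[of "int (Suc
      n)"] by (simp add: nat_add_distrib del: of_nat_Suc) (simp add: Suc_nat_eq_nat_zadd1)

lemma durfee_diff_rec: "durfee k - durfee (Suc k) = - (fps_X ^ Suc k) * (durfee (Suc k) - durfee (Suc
    (Suc k)))"
proof -
  let ?q = "\<lambda>n. inv_qfact (int n)"
  \<comment> \<open>\<open>A s - B s\<close> is the difference of the s-th terms, both brought to
    the denominator (q)_s (q)_(s+k+1). The factor 1 - q^s makes \<open>A\<close> vanish at s = 0, so
    \<open>A\<close> can be shifted by one index and then matched with \<open>B\<close>.\<close>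
  define A where "A s = fps_X ^ (s * (s + k)) * ((1 - fps_X ^ s) * ?q s * ?q (Suc (s + k)))" for s
  define B where "B s = fps_X ^ (s * (s + k)) * (fps_X ^ Suc (s + k) * ?q s * ?q (Suc (s + k)))" for s
  define C where "C s = fps_X ^ (s * (s + Suc k)) * (?q s * ?q (s + Suc k))" for s
  define D where "D s = fps_X ^ (s * (s + Suc (Suc k))) * (?q s * ?q (s + Suc (Suc k)))" for s
  have lf: "locally_finite A" "locally_finite B" "locally_finite C" "locally_finite D"
    unfolding A_def B_def C_def D_def by (rule locally_finite_durfee)+
  have "durfee k - durfee (Suc k) = fps_Sum (\<lambda>s. A s - B s)"
    unfolding durfee_def
    by (subst fps_Sum_diff[OF locally_finite_durfee locally_finite_durfee, symmetric], rule fps_Sum_cong)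
      (simp add: A_def B_def inv_qfact_nat_rec[of "_ + _"] power_add algebra_simps del: of_nat_Suc of_nat_add)
  also have "\<dots> = fps_Sum A - fps_Sum B"
    by (rule fps_Sum_diff[OF lf(1,2)])
  also have "fps_Sum A = fps_Sum (\<lambda>s. A (Suc s))"
    by (subst fps_Sum_nat_Suc[OF lf(1)]) (simp add: A_def)
  also have "\<dots> - fps_Sum B = fps_Sum (\<lambda>s. A (Suc s) - B s)"
    by (rule fps_Sum_diff[symmetric, OF locally_finite_inj[OF lf(1)] lf(2)]) simp
  also have "\<dots> = fps_Sum (\<lambda>s. - (fps_X ^ Suc k) * (C s - D s))"
  proof (rule fps_Sum_cong)
    fix s
    define Q R where "Q = ?q s" and "R = ?q (Suc (Suc (s + k)))"
    define x y z :: "real fps" where "x = fps_X ^ (s * (s + k))" and "y = fps_X ^ s" and "z = fps_X ^ Suc k"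
    have e: "fps_X ^ (Suc s * (Suc s + k)) = x * y * y * z" "fps_X ^ (s * (s + Suc k)) = x * y"
      "fps_X ^ (s * (s + Suc (Suc k))) = x * y * y" "fps_X ^ Suc (s + k) = y * z"
      "fps_X ^ Suc (Suc (s + k)) = fps_X * y * z"
      by (simp_all add: x_def y_def z_def power_add algebra_simps)
    have i: "?q (Suc (s + k)) = (1 - fps_X * y * z) * R" "(1 - fps_X ^ Suc s) * ?q (Suc s) = Q"
      unfolding Q_def R_def by (subst inv_qfact_nat_rec, simp add: y_def z_def power_add algebra_simps)+
    have AA: "A (Suc s) = x * y * y * z * Q * R"
      unfolding A_def e i by (simp add: R_def mult_ac)
    have BB: "B s = x * (y * z * Q * ((1 - fps_X * y * z) * R))"
      unfolding B_def e i by (simp add: x_def Q_def)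
    have CC: "C s = x * y * (Q * ((1 - fps_X * y * z) * R))"
      unfolding C_def e using i by (simp add: x_def Q_def)
    have DD: "D s = x * y * y * (Q * R)"
      unfolding D_def e by (simp add: x_def Q_def R_def)
    show "A (Suc s) - B s = - (fps_X ^ Suc k) * (C s - D s)"
      unfolding AA BB CC DD z_def[symmetric] by (simp add: algebra_simps)
  qed
  also have "\<dots> = - (fps_X ^ Suc k) * (fps_Sum C - fps_Sum D)"
    by (subst fps_Sum_mult_left) (simp_all only: fps_Sum_diff lf locally_finite_diff)
  also have "fps_Sum C = durfee (Suc k)"
    unfolding durfee_def by (rule fps_Sum_cong) (simp only: C_def)
  also have "fps_Sum D = durfee (Suc (Suc k))"
    unfolding durfee_def by (rule fps_Sum_cong) (simp only: D_def)
  finally show ?thesis .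
qed

text \<open>Classifying partitions by their Durfee rectangle of size s by s + k shows that every
  such sum is 1/(q)_infinity. Formally, iterating the recurrence puts ever higher powers of q in
  front of the difference, so all its coefficients vanish.\<close>

lemma durfee_const: "durfee k = durfee 0"
proof -
  have 0: "fps_nth (durfee k - durfee (Suc k)) N = 0" for k N
  proof (induction N arbitrary: k rule: less_induct)
    case (less N)
    show ?case
    proof (cases "N < Suc k")
      case False
      then show ?thesis
        using less[of "N - Suc k" "Suc k"] unfolding durfee_diff_rec[of k]
        by (simp add: fps_X_power_mult_nth del: power_Suc)
    qed (simp add: durfee_diff_rec[of k] fps_X_power_mult_nth del: power_Suc)
  qed
  have *: "durfee (Suc k) = durfee k" for k
    by (rule fps_ext) (use 0[of k] in simp)
  show ?thesis
  proof (induction k)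
    case (Suc k)
    with *[of k] show ?case by (rule trans)
  qed (rule refl)
qed

text \<open>The substitution n = s + |r| produces the Durfee sum with k = 2|r|. In Bailey's terms,
  q^(n^2) and q^(r^2)/(q)_infinity form a conjugate Bailey pair.\<close>

lemma sum_qbin_index:
  "fps_Sum (\<lambda>n. fps_X ^ n\<^sup>2 * qbin n r) = fps_X ^ nat (r\<^sup>2) * durfee 0"
proof -
  define m where "m = nat \<bar>r\<bar>"
  let ?F = "\<lambda>n. fps_X ^ n\<^sup>2 * qbin n r"
  have q: "qbin n r = inv_qfact (int n - int m) * inv_qfact (int n + int m)" for n
    by (cases "r \<ge> 0") (simp_all add: qbin_def m_def mult.commute)
  have lf: "locally_finite ?F"
    using locally_finite_durfee[of 0] by (simp add: power2_eq_square)
  have "fps_Sum ?F = fps_Sum (\<lambda>s. ?F (s + m))"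
  proof (rule fps_Sum_inj[OF lf, symmetric])
    show "?F j = 0" if "j \<notin> range (\<lambda>s. s + m)" for j
      using that rangeI[of "\<lambda>s. s + m" "j - m"] by (cases "j < m") (auto simp: q)
  qed (simp add: inj_def)
  also have "\<dots> = fps_Sum (\<lambda>s. fps_X ^ m\<^sup>2 * (fps_X ^ (s * (s + 2 * m)) * (inv_qfact
      (int s) * inv_qfact (int (s + 2 * m)))))"
  proof (rule fps_Sum_cong)
    fix s
    have "(s + m)\<^sup>2 = m\<^sup>2 + s * (s + 2 * m)" by (simp add: power2_eq_square algebra_simps)
    then show "?F (s + m) = fps_X ^ m\<^sup>2 * (fps_X ^ (s * (s + 2 * m)) * (inv_qfact (int s) *
        inv_qfact (int (s + 2 * m))))"
      by (simp add: q power_add mult.assoc add.commute)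
  qed
  also have "\<dots> = fps_X ^ m\<^sup>2 * durfee (2 * m)"
    unfolding durfee_def by (rule fps_Sum_mult_left[OF locally_finite_durfee])
  also have "m\<^sup>2 = nat (r\<^sup>2)" by (simp add: m_def nat_power_eq[symmetric])
  finally show ?thesis by (simp only: durfee_const[of "2 * m"])
qed

lemma locally_finite_square: "locally_finite (\<lambda>r. c r * fps_X ^ nat (r\<^sup>2))"
proof (rule locally_finite_X_power)
  have "{r. nat (r\<^sup>2) \<le> N} \<subseteq> {- int N..int N}" for N
  proof
    fix r assume "r \<in> {r. nat (r\<^sup>2) \<le> N}"
    then have "r\<^sup>2 \<le> int N" by (simp add: nat_le_iff)
    moreover have "\<bar>r\<bar> \<le> r\<^sup>2"
      using self_le_power[of "\<bar>r\<bar>" 2] by (cases "r = 0") auto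
    ultimately have "\<bar>r\<bar> \<le> int N" by linarith
    then show "r \<in> {- int N..int N}" by (simp add: abs_le_iff)
  qed
  then show "finite {r. nat (r\<^sup>2) \<le> N}" for N
    by (rule finite_subset) simp
qed

lemma bailey_lemma:
  "fps_Sum (\<lambda>n. fps_X ^ n\<^sup>2 * fps_Sum (\<lambda>r. c r * qbin n r))
    = durfee 0 * fps_Sum (\<lambda>r. c r * fps_X ^ nat (r\<^sup>2))"
proof -
  have lf: "locally_finite (\<lambda>(n, r). fps_X ^ n\<^sup>2 * (c r * qbin n r))"
  proof (rule locally_finiteI)
    fix N
    have *: "n \<in> {..N} \<and> r \<in> {- int N..int N}" if *: "fps_nth (fps_X ^ n\<^sup>2 * (c r *
        qbin n r)) N \<noteq> 0" for n r
    proof -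
      have "n\<^sup>2 \<le> N" using * by (simp only: fps_X_power_mult_nth split: if_splits)
      then have "n \<le> N" unfolding power2_eq_square by (rule le_of_mult_self_le)
      moreover have "\<bar>r\<bar> \<le> int n"
      proof (rule ccontr)
        assume "\<not> \<bar>r\<bar> \<le> int n"
        then have "qbin n r = 0" by (intro qbin_outside) simp
        with * show False by simp
      qed
      ultimately show ?thesis by auto
    qed
    have "{p. fps_nth (case p of (n, r) \<Rightarrow> fps_X ^ n\<^sup>2 * (c r * qbin n r)) N \<noteq>
        0} \<subseteq> {..N} \<times> {- int N..int N}"
    proof
      fix p assume p: "p \<in> {p. fps_nth (case p of (n, r) \<Rightarrow> fps_X ^ n\<^sup>2 * (c r *
          qbin n r)) N \<noteq> 0}"
      show "p \<in> {..N} \<times> {- int N..int N}"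
        using p unfolding mem_Collect_eq split_def mem_Times_iff by (rule *)
    qed
    then show "finite {p. fps_nth (case p of (n, r) \<Rightarrow> fps_X ^ n\<^sup>2 * (c r * qbin n r))
        N \<noteq> 0}"
      by (rule finite_subset) simp
  qed
  have "fps_Sum (\<lambda>n. fps_X ^ n\<^sup>2 * fps_Sum (\<lambda>r. c r * qbin n r))
      = fps_Sum (\<lambda>n. fps_Sum (\<lambda>r. fps_X ^ n\<^sup>2 * (c r * qbin n r)))"
    by (simp add: fps_Sum_mult_left locally_finite_qbin)
  also have "\<dots> = fps_Sum (\<lambda>r. fps_Sum (\<lambda>n. fps_X ^ n\<^sup>2 * (c r * qbin n r)))"
    by (rule fps_Sum_swap[OF lf])
  also have "\<dots> = fps_Sum (\<lambda>r. durfee 0 * (c r * fps_X ^ nat (r\<^sup>2)))"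
  proof (rule fps_Sum_cong)
    fix r
    have "locally_finite (\<lambda>n. fps_X ^ n\<^sup>2 * qbin n r)"
      using locally_finite_durfee[of 0] by (simp add: power2_eq_square)
    then have "fps_Sum (\<lambda>n. c r * (fps_X ^ n\<^sup>2 * qbin n r)) = c r * (fps_X ^ nat
        (r\<^sup>2) * durfee 0)"
      by (simp only: fps_Sum_mult_left sum_qbin_index)
    moreover have "fps_Sum (\<lambda>n. fps_X ^ n\<^sup>2 * (c r * qbin n r)) = fps_Sum (\<lambda>n. c r
        * (fps_X ^ n\<^sup>2 * qbin n r))"
      by (rule fps_Sum_cong) (rule mult.left_commute)
    ultimately show "fps_Sum (\<lambda>n. fps_X ^ n\<^sup>2 * (c r * qbin n r)) = durfee 0 * (c r *
        fps_X ^ nat (r\<^sup>2))"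
      by (simp add: mult_ac del: nat_power_eq)
  qed
  also have "\<dots> = durfee 0 * fps_Sum (\<lambda>r. c r * fps_X ^ nat (r\<^sup>2))"
    by (rule fps_Sum_mult_left[OF locally_finite_square])
  finally show ?thesis .
qed

definition pentagonal_series :: "real fps" where
  "pentagonal_series = fps_Sum (\<lambda>r. alt r * fps_X ^ tri r * fps_X ^ nat (r\<^sup>2))"
definition watson_series :: "real fps" where
  "watson_series = fps_Sum (\<lambda>r. watson_coeff r * fps_X ^ nat (r\<^sup>2))"

text \<open>For the unit Bailey pair the left side of Bailey's lemma collapses to its term n = 0.
  This replaces Euler's pentagonal number theorem and avoids infinite products.\<close>

lemma durfee_mult_pentagonal: "durfee 0 * pentagonal_series = 1"
proof -
  have "fps_X ^ n\<^sup>2 * fps_Sum (\<lambda>r. alt r * fps_X ^ tri r * qbin n r) = 0" if "n \<notin>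
      {0}" for n
    using sum_qbin_alternating(1)[of n] that by simp
  then have "fps_Sum (\<lambda>n. fps_X ^ n\<^sup>2 * fps_Sum (\<lambda>r. alt r * fps_X ^ tri r * qbin n r))
      = (\<Sum>n\<in>{0}. fps_X ^ n\<^sup>2 * fps_Sum (\<lambda>r. alt r * fps_X ^ tri r * qbin n r))"
    by (intro fps_Sum_eq_sum) auto
  also have "\<dots> = fps_Sum (\<lambda>r. alt r * fps_X ^ tri r * qbin 0 r)" by simp
  also have "\<dots> = (\<Sum>r\<in>{0}. alt r * fps_X ^ tri r * qbin 0 r)"
    by (rule fps_Sum_eq_sum) (auto simp: qbin_outside)
  also have "\<dots> = 1" by (simp add: qbin_def tri_def)
  finally show ?thesis unfolding bailey_lemma pentagonal_series_def .
qed

lemma mock_f_eq_fps_Sum: "mock_f = fps_Sum mock_f_term"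
proof -
  have lf: "locally_finite mock_f_term"
    using locally_finite_durfee[of 0] unfolding mock_f_term_eq by (simp add: power2_eq_square)
  have "suminf (\<lambda>n. mock_f_term (Suc n)) = fps_Sum (\<lambda>n. mock_f_term (Suc n))"
  proof (rule fps_ext)
    fix m
    have "fps_nth (fps_Sum (\<lambda>n. mock_f_term (Suc n))) m = (\<Sum>n<m. fps_nth (mock_f_term (Suc
        n)) m)"
    proof (rule fps_Sum_nth)
      show "fps_nth (mock_f_term (Suc n)) m = 0" if "n \<notin> {..<m}" for n
        by (rule mock_f_term_nth_eq_0) (use that in \<open>simp add: power2_eq_square\<close>)
    qed simp
    then show "fps_nth (suminf (\<lambda>n. mock_f_term (Suc n))) m = fps_nth (fps_Sum (\<lambda>n.
        mock_f_term (Suc n))) m"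
      using sums_unique[OF mock_f_sums] by (metis fps_nth_Abs_fps)
  qed
  moreover have "mock_f_term 0 = 1" by (simp add: mock_f_term_def)
  ultimately show ?thesis
    unfolding mock_f_def by (simp add: fps_Sum_nat_Suc[OF lf])
qed

text \<open>Bailey's lemma turns the series of f, term by term q^(n^2) times the second member of a
  Bailey pair, into \<open>durfee 0 * watson_series\<close>; \<open>pentagonal_series\<close>
  cancels \<open>durfee 0\<close>.\<close>

lemma watson_mock_f: "mock_f * pentagonal_series = watson_series"
proof -
  have "mock_f_term n = fps_X ^ n\<^sup>2 * fps_Sum (\<lambda>r. watson_coeff r * qbin n r)" for n
    unfolding mock_f_term_eq
    using fps_inverse_unique[of "\<Prod>k=1..n. (1 + fps_X ^ k)\<^sup>2" "fps_Sum (\<lambda>r.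
        watson_coeff r * qbin n r)"] sum_watson_coeff_qbin[of n]
    by (simp add: mult.commute)
  then have "mock_f = durfee 0 * watson_series"
    unfolding mock_f_eq_fps_Sum watson_series_def bailey_lemma[symmetric] by (rule fps_Sum_cong)
  then show ?thesis using durfee_mult_pentagonal by (metis mult.commute mult.left_commute mult_1)
qed

subsection \<open>Convolution of theta coefficients with partial theta functions\<close>

text \<open>The factor (-1)^k is kept apart in \<open>alt\<close>, because it cancels on evaluation
  at x = -1.\<close>

definition theta_sign :: "int \<Rightarrow> real fps" where
  "theta_sign k = (if k mod 3 = 0 then 1 else if k mod 3 = 1 then - 1 else 0)"

definition theta_exp :: "int \<Rightarrow> nat" where
  "theta_exp k = nat (k * (k - 1) div 6)"

text \<open>The coefficient of x^k in R(x). In both residue classes k = 3m + 1 and k = -3m the exponent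
  m(3m+1)/2 equals k(k-1)/6.\<close>

definition theta_coeff :: "int \<Rightarrow> real fps" where
  "theta_coeff k = alt k * theta_sign k * fps_X ^ theta_exp k"

lemma six_dvd: "k mod 3 \<noteq> 2 \<Longrightarrow> 6 dvd k * (k - 1 :: int)"
proof -
  assume "k mod 3 \<noteq> 2"
  then have "k mod 3 = 0 \<or> k mod 3 = 1" by presburger
  then have "3 dvd k \<or> 3 dvd k - 1" by presburger
  then have "3 dvd k * (k - 1)" by auto
  then obtain c where c: "k * (k - 1) = 3 * c" by (rule dvdE)
  have "even (k * (k - 1))" by simp
  then have "even c" unfolding c by simp
  then show ?thesis unfolding c by presburger
qed

lemma int_theta_exp: "k mod 3 \<noteq> 2 \<Longrightarrow> 6 * int (theta_exp k) = k * (k - 1)"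
  using six_dvd[of k] tri_nonneg[of k] unfolding theta_exp_def by auto

lemma theta_coeff_eq_0: "k mod 3 = 2 \<Longrightarrow> theta_coeff k = 0"
  by (simp add: theta_coeff_def theta_sign_def)

lemma locally_finite_theta_coeff: "locally_finite theta_coeff"
proof -
  have "{k. theta_exp k \<le> N} \<subseteq> {- int (6 * N + 7)..int (6 * N + 7)}" for N
  proof
    fix k assume "k \<in> {k. theta_exp k \<le> N}"
    then have *: "k * (k - 1) < 6 * int N + 6" by (auto simp: theta_exp_def)
    have "\<bar>k\<bar> \<le> k * (k - 1) + 1"
      using zero_le_square[of k] zero_le_square[of "k - 1"] by (cases "k \<ge>
          0") (simp_all add: algebra_simps)
    with * show "k \<in> {- int (6 * N + 7)..int (6 * N + 7)}" by auto
  qed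
  then have "finite {k. theta_exp k \<le> N}" for N by (rule finite_subset) simp
  from locally_finite_X_power[OF this] show ?thesis unfolding theta_coeff_def .
qed

lemma theta_coeff_reflect: "theta_coeff (1 - k) = theta_coeff k"
proof -
  have "theta_exp (1 - k) = theta_exp k" by (simp add: theta_exp_def algebra_simps)
  moreover have "(1 - k) mod 3 = (if k mod 3 = 0 then 1 else if k mod 3 = 1 then 0 else 2)"
    by presburger
  ultimately show ?thesis by (simp add: theta_coeff_def theta_sign_def)
qed

text \<open>The equation R(qx) = - R(x) / (q x^3) read off at x^(l+3), in two forms so that the
  exponent of q is natural in either range.\<close>

lemma theta_coeff_rec:
  shows "l \<ge> - 1 \<Longrightarrow> theta_coeff (l + 3) = - (fps_X ^ nat (l + 1) * theta_coeff l)"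
    and "l \<le> - 1 \<Longrightarrow> theta_coeff l = - (fps_X ^ nat (- 1 - l) * theta_coeff (l + 3))"
proof -
  have p: "theta_sign (l + 3) = theta_sign l" by (simp add: theta_sign_def)
  have a: "alt (l + 3) = - alt l" by (simp add: alt_def)
  have h: "int (theta_exp (l + 3)) = int (theta_exp l) + l + 1" if "l mod 3 \<noteq> 2"
  proof -
    have "6 * int (theta_exp l) = l * (l - 1)"
      by (rule int_theta_exp[OF that])
    moreover have "6 * int (theta_exp (l + 3)) = (l + 3) * (l + 3 - 1)"
      by (rule int_theta_exp) (use that in simp)
    ultimately show ?thesis by (simp add: algebra_simps)
  qed
  show "theta_coeff (l + 3) = - (fps_X ^ nat (l + 1) * theta_coeff l)" if "l \<ge> - 1"
  proof (cases "l mod 3 = 2")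
    case False
    then have "theta_exp (l + 3) = theta_exp l + nat (l + 1)" using h that by linarith
    then show ?thesis by (simp add: theta_coeff_def p a power_add mult_ac)
  qed (simp add: theta_coeff_eq_0)
  show "theta_coeff l = - (fps_X ^ nat (- 1 - l) * theta_coeff (l + 3))" if "l \<le> - 1"
  proof (cases "l mod 3 = 2")
    case False
    then have "theta_exp l = theta_exp (l + 3) + nat (- 1 - l)" using h that by linarith
    then show ?thesis by (simp add: theta_coeff_def p a power_add mult_ac)
  qed (simp add: theta_coeff_eq_0)
qed

text \<open>The reflection k -> 1 - k exchanges the classes 0 and 1 modulo 3; pairing 3r with 1 - 3r
  makes the symmetry of \<open>theta_coeff\<close> applicable.\<close>

lemma fps_Sum_mod3:
  fixes F :: "int \<Rightarrow> 'a::comm_ring_1 fps"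
  assumes lf: "locally_finite F" and 2: "\<And>k. k mod 3 = 2 \<Longrightarrow> F k = 0"
  shows "fps_Sum F = fps_Sum (\<lambda>r. F (3 * r) + F (1 - 3 * r))"
proof -
  let ?A = "\<lambda>k. if k mod 3 = 0 then F k else 0" and ?B = "\<lambda>k. if k mod 3 = 1 then F k else 0"
  have A: "locally_finite ?A"
    using locally_finite_mult(1)[OF lf, of "\<lambda>k. if k mod 3 = 0 then 1 else 0"]
    by (rule back_subst[of locally_finite]) auto
  have B: "locally_finite ?B"
    using locally_finite_mult(1)[OF lf, of "\<lambda>k. if k mod 3 = 1 then 1 else 0"]
    by (rule back_subst[of locally_finite]) auto
  have ia: "inj (\<lambda>r::int. 3 * r)" and ib: "inj (\<lambda>r::int. 1 - 3 * r)"
    by (auto simp: inj_def)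
  have "F k = ?A k + ?B k" for k
  proof -
    have "k mod 3 = 0 \<or> k mod 3 = 1 \<or> k mod 3 = 2" by presburger
    then show ?thesis by (elim disjE) (simp_all add: 2)
  qed
  then have "fps_Sum F = fps_Sum (\<lambda>k. ?A k + ?B k)"
    by (rule fps_Sum_cong)
  also have "\<dots> = fps_Sum ?A + fps_Sum ?B"
    by (rule fps_Sum_add[OF A B])
  also have "fps_Sum ?A = fps_Sum (\<lambda>r. ?A (3 * r))"
  proof (rule fps_Sum_inj[OF A ia, symmetric])
    show "?A j = 0" if "j \<notin> range (\<lambda>r. 3 * r)" for j
      using that rangeI[of "\<lambda>r. 3 * r" "j div 3"] by (auto split: if_splits)
  qed
  also have "fps_Sum ?B = fps_Sum (\<lambda>r. ?B (1 - 3 * r))"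
  proof (rule fps_Sum_inj[OF B ib, symmetric])
    show "?B j = 0" if "j \<notin> range (\<lambda>r. 1 - 3 * r)" for j
    proof (cases "j mod 3 = 1")
      case True
      then have "j = 1 - 3 * (- (j div 3))" by presburger
      with that show ?thesis by (metis rangeI)
    qed simp
  qed
  also have "fps_Sum (\<lambda>r. ?A (3 * r)) + fps_Sum (\<lambda>r. ?B (1 - 3 * r)) = fps_Sum
      (\<lambda>r. ?A (3 * r) + ?B (1 - 3 * r))"
    by (rule fps_Sum_add[symmetric, OF locally_finite_inj[OF A ia] locally_finite_inj[OF B ib]])
  also have "\<dots> = fps_Sum (\<lambda>r. F (3 * r) + F (1 - 3 * r))"
  proof (rule fps_Sum_cong)
    fix r :: int
    have "(1 - 3 * r) mod 3 = 1" "3 * r mod 3 = 0" by presburger+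
    then show "?A (3 * r) + ?B (1 - 3 * r) = F (3 * r) + F (1 - 3 * r)" by (simp only: simp_thms if_True)
  qed
  finally show ?thesis .
qed

lemma theta_coeff_3: "theta_coeff (3 * r) = alt r * fps_X ^ theta_exp (3 * r)"
  by (simp add: theta_coeff_def theta_sign_def alt_def)

lemma theta_coeff_3_pentagonal: "theta_coeff (3 * r) = alt r * fps_X ^ tri r * fps_X ^ nat (r\<^sup>2)"
proof -
  have "2 * int (theta_exp (3 * r)) = 2 * int (tri r + nat (r\<^sup>2))"
    unfolding of_nat_add distrib_left int_tri using int_theta_exp[of "3 * r"]
    by (simp add: algebra_simps power2_eq_square)
  then have "theta_exp (3 * r) = tri r + nat (r\<^sup>2)"
    by (simp only: mult_cancel_left of_nat_eq_iff) simp
  then show ?thesis by (simp add: theta_coeff_3 power_add mult.assoc)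
qed

lemma sum_theta_coeff: "fps_Sum theta_coeff = 2 * pentagonal_series"
proof -
  have "fps_Sum theta_coeff = fps_Sum (\<lambda>r. theta_coeff (3 * r) + theta_coeff (1 - 3 * r))"
    by (rule fps_Sum_mod3[OF locally_finite_theta_coeff theta_coeff_eq_0])
  also have "\<dots> = fps_Sum (\<lambda>r. 2 * theta_coeff (3 * r))"
    by (simp add: theta_coeff_reflect)
  also have "\<dots> = 2 * fps_Sum (\<lambda>r. theta_coeff (3 * r))"
    by (rule fps_Sum_mult_left[OF locally_finite_inj[OF locally_finite_theta_coeff]]) (simp add: inj_def)
  also have "fps_Sum (\<lambda>r. theta_coeff (3 * r)) = pentagonal_series"
    unfolding pentagonal_series_def by (rule fps_Sum_cong) (rule theta_coeff_3_pentagonal)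
  finally show ?thesis .
qed

lemma sum_alt_theta_coeff: "fps_Sum (\<lambda>k. alt k * theta_coeff k) = 0"
proof -
  have "fps_Sum (\<lambda>k. alt k * theta_coeff k) = fps_Sum (\<lambda>r. alt (3 * r) * theta_coeff (3
      * r) + alt (1 - 3 * r) * theta_coeff (1 - 3 * r))"
    by (rule fps_Sum_mod3[OF locally_finite_mult(2)[OF locally_finite_theta_coeff]]) (simp add: theta_coeff_eq_0)
  also have "\<dots> = fps_Sum (\<lambda>r::int. 0)"
    by (simp add: theta_coeff_reflect)
  finally show ?thesis by (simp add: fps_Sum_eq_sum[of "{}"])
qed

definition theta :: "real fps" where
  "theta = fps_Sum (\<lambda>m. of_int (6 * m + 1) * fps_X ^ nat ((3 * m\<^sup>2 + m) div 2))"

lemma theta_eq: "theta = - fps_Sum (\<lambda>k. of_int k * alt k * theta_coeff k)"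
proof -
  have lf: "locally_finite (\<lambda>k. of_int k * alt k * theta_coeff k)"
    by (rule locally_finite_mult(2)[OF locally_finite_theta_coeff])
  have "fps_Sum (\<lambda>k. of_int k * alt k * theta_coeff k)
      = fps_Sum (\<lambda>r. of_int (3 * r) * alt (3 * r) * theta_coeff (3 * r) + of_int (1 - 3 * r) * alt (1 - 3 * r) * theta_coeff (1 - 3 * r))"
    by (rule fps_Sum_mod3[OF lf]) (simp add: theta_coeff_eq_0)
  also have "\<dots> = fps_Sum (\<lambda>r. of_int (6 * r - 1) * alt (3 * r) * theta_coeff (3 * r))"
    by (rule fps_Sum_cong) (simp add: theta_coeff_reflect algebra_simps)
  \<comment> \<open>Replacing r by -m turns the exponent r(3r-1)/2 into m(3m+1)/2 and the weight 6r
    - 1 into -(6m + 1).\<close>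
  also have "\<dots> = fps_Sum (\<lambda>m. of_int (6 * (0 - m) - 1) * alt (3 * (0 - m)) * theta_coeff
      (3 * (0 - m)))"
    using fps_Sum_reindex[OF bij_int_reflect, of "\<lambda>r. of_int (6 * r - 1) * alt (3 * r) *
        theta_coeff (3 * r)" 0] by simp
  also have "\<dots> = fps_Sum (\<lambda>m. (- 1) * ((of_int (6 * m + 1) * alt m) * theta_coeff (3 * (0
      - m))))"
    by (rule fps_Sum_cong) (simp add: alt_def algebra_simps)
  also have "\<dots> = (- 1) * fps_Sum (\<lambda>m. (of_int (6 * m + 1) * alt m) * theta_coeff (3 * (0 - m)))"
    by (intro fps_Sum_mult_left locally_finite_mult(2) locally_finite_inj[OF locally_finite_theta_coeff])
      (simp add: inj_def)
  also have "fps_Sum (\<lambda>m. (of_int (6 * m + 1) * alt m) * theta_coeff (3 * (0 - m))) = theta"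
    unfolding theta_def
  proof (rule fps_Sum_cong)
    fix m :: int
    define h where "h = theta_exp (3 * (0 - m))"
    have "6 * int h = 3 * (3 * m\<^sup>2 + m)"
      unfolding h_def by (subst int_theta_exp) (simp_all add: power2_eq_square algebra_simps)
    then have "3 * m\<^sup>2 + m = 2 * int h" by simp
    then have "h = nat ((3 * m\<^sup>2 + m) div 2)" by simp
    then have "theta_exp (3 * (0 - m)) = nat ((3 * m\<^sup>2 + m) div 2)" unfolding h_def .
    then have "theta_coeff (3 * (0 - m)) = alt m * fps_X ^ nat ((3 * m\<^sup>2 + m) div 2)"
      by (simp only: theta_coeff_3) (simp add: alt_def)
    then show "of_int (6 * m + 1) * alt m * theta_coeff (3 * (0 - m)) =
      of_int (6 * m + 1) * fps_X ^ nat ((3 * m\<^sup>2 + m) div 2)"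
      by (simp add: alt_def)
  qed
  finally show ?thesis by simp
qed

section \<open>Partial theta functions as Laurent coefficients of A\<close>

definition pent :: "nat \<Rightarrow> nat" where
  "pent n = n * (3 * n + 1) div 2"

lemma double_pent: "2 * pent n = n * (3 * n + 1)"
  unfolding pent_def by simp

definition partial_theta :: "nat \<Rightarrow> real fps" where
  "partial_theta j = fps_Sum (\<lambda>n. alt (int n) * fps_X ^ (pent n + n * j))"

lemma finite_pent_le: "finite {n. pent n + c n \<le> N}"
proof -
  have *: "n \<le> pent n" for n
  proof -
    have "2 * pent n = 3 * (n * n) + n" using double_pent[of n] by (simp add: algebra_simps)
    then show ?thesis using le_square[of n] by linarith
  qed
  have "{n. pent n + c n \<le> N} \<subseteq> {..N}"
  proof
    fix n assume "n \<in> {n. pent n + c n \<le> N}"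
    with *[of n] show "n \<in> {..N}" by simp
  qed
  then show ?thesis by (rule finite_subset) simp
qed

lemma locally_finite_partial_theta: "locally_finite (\<lambda>n. alt (int n) * fps_X ^ (pent n + n * j))"
  by (rule locally_finite_X_power[OF finite_pent_le])

text \<open>Shifting n by one gives pent(n+1) + (n+1) i = (i+2) + pent(n) + n (i+3); the 1 is the
  term n = 0.\<close>

lemma partial_theta_rec: "fps_X ^ (i + 2) * partial_theta (i + 3) = 1 - partial_theta i"
proof -
  have "partial_theta i = 1 + fps_Sum (\<lambda>n. alt (int (Suc n)) * fps_X ^ (pent (Suc n) + Suc n * i))"
    unfolding partial_theta_def by (subst fps_Sum_nat_Suc[OF locally_finite_partial_theta]) (simp add: pent_def)
  also have "fps_Sum (\<lambda>n. alt (int (Suc n)) * fps_X ^ (pent (Suc n) + Suc n * i))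
     = fps_Sum (\<lambda>n. - (fps_X ^ (i + 2)) * (alt (int n) * fps_X ^ (pent n + n * (i + 3))))"
  proof (rule fps_Sum_cong)
    fix n
    have "2 * (pent (Suc n) + Suc n * i) = 2 * ((i + 2) + (pent n + n * (i + 3)))"
      unfolding distrib_left double_pent by (simp add: algebra_simps)
    then have e: "pent (Suc n) + Suc n * i = (i + 2) + (pent n + n * (i + 3))"
      by (simp only: mult_cancel_left) simp
    show "alt (int (Suc n)) * fps_X ^ (pent (Suc n) + Suc n * i)
      = - (fps_X ^ (i + 2)) * (alt (int n) * fps_X ^ (pent n + n * (i + 3)))"
      unfolding e power_add[of fps_X "i + 2"] by simp
  qed
  also have "\<dots> = - (fps_X ^ (i + 2)) * partial_theta (i + 3)"
    unfolding partial_theta_def by (rule fps_Sum_mult_left[OF locally_finite_partial_theta])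
  finally show ?thesis by simp
qed

lemma locally_finite_pentagonal: "locally_finite (\<lambda>r. alt r * fps_X ^ tri r * fps_X ^ nat
    (r\<^sup>2))"
  unfolding theta_coeff_3_pentagonal[symmetric] by (rule locally_finite_inj[OF locally_finite_theta_coeff]) (simp add: inj_def)

text \<open>The terms r <= 0 of P make up \<open>partial_theta 0\<close>, the terms r >= 1 the other
  summand. This is how P enters the functional equation of A, at the exponents 0 and 2 of x.\<close>

lemma partial_theta_pentagonal: "partial_theta 0 - fps_X * partial_theta 2 = pentagonal_series"
proof -
  let ?E = "\<lambda>r. alt r * fps_X ^ tri r * fps_X ^ nat (r\<^sup>2)"
  have lf: "locally_finite (\<lambda>n. ?E (int n))"
    by (rule locally_finite_inj[OF locally_finite_pentagonal]) (simp add: inj_def)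
  have "pentagonal_series = fps_Sum (\<lambda>n. ?E (int n)) + fps_Sum (\<lambda>n. ?E (- 1 - int n))"
    unfolding pentagonal_series_def by (rule fps_Sum_int_split[OF locally_finite_pentagonal])
  also have "fps_Sum (\<lambda>n. ?E (int n)) = 1 + fps_Sum (\<lambda>n. ?E (int (Suc n)))"
    using fps_Sum_nat_Suc[OF lf] by (simp add: tri_def)
  also have "fps_Sum (\<lambda>n. ?E (int (Suc n))) = fps_Sum (\<lambda>n. - fps_X * (alt (int n) *
      fps_X ^ (pent n + n * 2)))"
  proof (rule fps_Sum_cong)
    fix n
    have "int (2 * (tri (int (Suc n)) + nat ((int (Suc n))\<^sup>2))) = int (2 * Suc (pent n + n * 2))"
      using int_tri[of "int (Suc n)"] arg_cong[OF double_pent[of n], of int]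
      by (simp add: algebra_simps power2_eq_square)
    then have "tri (int (Suc n)) + nat ((int (Suc n))\<^sup>2) = Suc (pent n + n * 2)"
      unfolding of_nat_eq_iff by (simp only: mult_cancel_left) simp
    then show "?E (int (Suc n)) = - fps_X * (alt (int n) * fps_X ^ (pent n + n * 2))"
      unfolding mult.assoc power_add[symmetric] by simp
  qed
  also have "\<dots> = - fps_X * partial_theta 2"
    unfolding partial_theta_def by (rule fps_Sum_mult_left[OF locally_finite_partial_theta])
  also have "fps_Sum (\<lambda>n. ?E (- 1 - int n)) = fps_Sum (\<lambda>n. alt (int (Suc n)) * fps_X ^
      (pent (Suc n) + Suc n * 0))"
  proof (rule fps_Sum_cong)
    fix n
    have "int (2 * (tri (- 1 - int n) + nat ((- 1 - int n)\<^sup>2))) = int (2 * pent (Suc n))"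
      using int_tri[of "- 1 - int n"] arg_cong[OF double_pent[of "Suc n"], of int]
      by (simp add: algebra_simps power2_eq_square)
    then have "tri (- 1 - int n) + nat ((- 1 - int n)\<^sup>2) = pent (Suc n) + Suc n * 0"
      unfolding of_nat_eq_iff by (simp only: mult_cancel_left) simp
    then show "?E (- 1 - int n) = alt (int (Suc n)) * fps_X ^ (pent (Suc n) + Suc n * 0)"
      unfolding mult.assoc power_add[symmetric] by (simp add: alt_def)
  qed
  also have "\<dots> = partial_theta 0 - 1"
    unfolding partial_theta_def by (subst fps_Sum_nat_Suc[OF locally_finite_partial_theta, of 0]) (simp add: pent_def)
  finally show ?thesis by simp
qed

text \<open>The coefficient of x^j in the expansion of A(x) in the annulus |q| < |x| < 1. The sum over n >= 0
  contributes to j >= 0 and the sum over n < 0 to j < 0; the latter is rewritten by the symmetry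
  A(1/x) = - x A(x).\<close>

definition partial_theta_int :: "int \<Rightarrow> real fps" where
  "partial_theta_int j = (if j \<ge> 0 then partial_theta (nat j) else 1 - partial_theta (nat (- 1 - j)))"

lemma partial_theta_int_reflect: "partial_theta_int (- 1 - j) = 1 - partial_theta_int j"
  by (simp add: partial_theta_int_def)

text \<open>The functional equation of A at exponents outside 0, 1, 2, where P does not enter; the 1
  is the jump across the pole at x = 1. The second form is the first one under j -> 2 - j.\<close>

lemma partial_theta_int_rec:
  shows "j \<ge> 3 \<Longrightarrow> fps_X ^ nat (j - 1) * partial_theta_int j = 1 - partial_theta_int
      (j - 3)"
    and "j \<le> - 1 \<Longrightarrow> partial_theta_int j = fps_X ^ nat (1 - j) * (1 -
        partial_theta_int (j - 3))"
proof -
  show "fps_X ^ nat (j - 1) * partial_theta_int j = 1 - partial_theta_int (j - 3)" if "j \<ge> 3" for j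
  proof -
    have "nat (j - 1) = nat (j - 3) + 2" "nat j = nat (j - 3) + 3" using that by simp_all
    then show ?thesis using that partial_theta_rec[of "nat (j - 3)"] by (simp add: partial_theta_int_def)
  qed
  from this[of "2 - j"] show "partial_theta_int j = fps_X ^ nat (1 - j) * (1 - partial_theta_int (j -
      3))" if "j \<le> - 1"
    using that partial_theta_int_reflect[of "2 - j"] partial_theta_int_reflect[of "- 1 - j"] by simp
qed

section \<open>The Laurent coefficients of E = R A\<close>

definition theta_conv :: "int \<Rightarrow> real fps" where
  "theta_conv k = fps_Sum (\<lambda>j. theta_coeff (k - j) * partial_theta_int j)"

lemma locally_finite_theta_coeff_reflect: "locally_finite (\<lambda>j. theta_coeff (k - j) * c j)"
  by (rule locally_finite_mult(1)[OF locally_finite_inj[OF locally_finite_theta_coeff]]) (simp add: inj_def)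

lemma sum_theta_coeff_reflect: "fps_Sum (\<lambda>j. theta_coeff (k - j)) = 2 * pentagonal_series"
  unfolding sum_theta_coeff[symmetric] by (rule fps_Sum_reindex[OF bij_int_reflect])

text \<open>Under x -> 1/x the product E changes its sign, but the resulting expansion belongs to
  |x| > 1; returning across the pole at x = 1 adds R(1) = 2 P to each coefficient.\<close>

lemma theta_conv_reflect: "theta_conv (- k) = 2 * pentagonal_series - theta_conv k"
proof -
  have "theta_conv (- k) = fps_Sum (\<lambda>i. theta_coeff (- k - (- 1 - i)) * partial_theta_int (- 1 - i))"
    unfolding theta_conv_def using fps_Sum_reindex[OF bij_int_reflect, of "\<lambda>j. theta_coeff (- k
        - j) * partial_theta_int j" "- 1"] by simp
  also have "\<dots> = fps_Sum (\<lambda>i. theta_coeff (k - i) * 1 - theta_coeff (k - i) *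
      partial_theta_int i)"
  proof (rule fps_Sum_cong)
    fix i
    have "theta_coeff (- k - (- 1 - i)) = theta_coeff (k - i)"
      using theta_coeff_reflect[of "k - i"] by (simp add: algebra_simps)
    then show "theta_coeff (- k - (- 1 - i)) * partial_theta_int (- 1 - i) = theta_coeff (k - i) * 1 -
        theta_coeff (k - i) * partial_theta_int i"
      by (simp only: partial_theta_int_reflect right_diff_distrib)
  qed
  also have "\<dots> = fps_Sum (\<lambda>i. theta_coeff (k - i) * 1) - theta_conv k"
    unfolding theta_conv_def by (rule fps_Sum_diff[OF locally_finite_theta_coeff_reflect locally_finite_theta_coeff_reflect])
  finally show ?thesis by (simp add: sum_theta_coeff_reflect)
qed

lemma theta_conv_0: "theta_conv 0 = pentagonal_series"
proof -
  have "2 * theta_conv 0 = 2 * pentagonal_series" using theta_conv_reflect[of 0] by simp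
  then show ?thesis by simp
qed

text \<open>The recurrence of \<open>theta_coeff\<close> moves k - j to k + 3 - j and that of
  \<open>partial_theta_int\<close> moves j to j - 3, so multiplication by q^k reproduces the
  convolution summand with j shifted by 3. P enters only at j = 0 and j = 2.\<close>

lemma theta_conv_term_rec:
  assumes "k \<ge> 1"
  shows "fps_X ^ nat k * (theta_coeff (k - j) * partial_theta_int j)
    = theta_coeff (k + 3 - j) * (partial_theta_int (j - 3) - 1)
      + pentagonal_series * (if j = 0 then fps_X ^ nat k * theta_coeff k else if j = 2 then theta_coeff (k + 1) else 0)"
proof -
  define l where "l = k - j"
  have k3: "k + 3 - j = l + 3" by (simp add: l_def)
  \<comment> \<open>Apart from j = 0, 1, 2 the cases follow the signs of the exponents; j <= -1
    forces l >= -1 because k >= 1.\<close>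
  consider "j \<ge> 3" "l \<ge> - 1" | "j \<ge> 3" "l \<le> - 1" | "j \<le> - 1" "l \<ge> - 1" | "j =
      0" | "j = 1" | "j = 2"
    using assms by (fastforce simp: l_def)
  then show ?thesis
  proof cases
    case 1
    then have "nat k = nat (l + 1) + nat (j - 1)" by (simp add: l_def)
    then have "fps_X ^ nat k * (theta_coeff l * partial_theta_int j) = (fps_X ^ nat (l + 1) *
        theta_coeff l) * (fps_X ^ nat (j - 1) * partial_theta_int j)"
      by (simp add: power_add mult_ac)
    also have "\<dots> = - theta_coeff (l + 3) * (1 - partial_theta_int (j - 3))"
      unfolding partial_theta_int_rec(1)[OF 1(1)] theta_coeff_rec(1)[OF 1(2)] by simp
    finally show ?thesis using 1 by (simp add: k3 l_def[symmetric] algebra_simps)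
  next
    case 2
    then have "nat (j - 1) = nat k + nat (- 1 - l)" using assms by (simp add: l_def)
    then have "fps_X ^ nat k * (theta_coeff l * partial_theta_int j) = - (theta_coeff (l + 3) * (fps_X ^
        nat (j - 1) * partial_theta_int j))"
      by (simp add: theta_coeff_rec(2)[OF 2(2)] power_add mult_ac)
    also have "\<dots> = - theta_coeff (l + 3) * (1 - partial_theta_int (j - 3))"
      unfolding partial_theta_int_rec(1)[OF 2(1)] by simp
    finally show ?thesis using 2 by (simp add: k3 l_def[symmetric] algebra_simps)
  next
    case 3
    then have "nat (l + 1) = nat k + nat (1 - j)" using assms by (simp add: l_def)
    then have "fps_X ^ nat k * (theta_coeff l * partial_theta_int j) = (fps_X ^ nat (l + 1) *
        theta_coeff l) * (1 - partial_theta_int (j - 3))"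
      by (simp add: partial_theta_int_rec(2)[OF 3(1)] power_add mult_ac)
    also have "\<dots> = - theta_coeff (l + 3) * (1 - partial_theta_int (j - 3))"
      unfolding theta_coeff_rec(1)[OF 3(2)] by simp
    finally show ?thesis using 3 by (simp add: k3 l_def[symmetric] algebra_simps)
  next
    case 4
    have "nat (k + 1) = Suc (nat k)" using assms by simp
    then have r: "theta_coeff (k + 3) = - (fps_X * fps_X ^ nat k * theta_coeff k)"
      using assms theta_coeff_rec(1)[of k] by simp
    have a0: "partial_theta_int 0 = pentagonal_series + fps_X * partial_theta_int
        2" using partial_theta_pentagonal by (simp add: partial_theta_int_def algebra_simps)
    have a3: "partial_theta_int (- 3) = 1 - partial_theta_int 2" using partial_theta_int_reflect[of 2] by simp
    show ?thesis using 4 by (simp add: r a0 a3 algebra_simps)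
  next
    case 5
    have r: "theta_coeff (k + 2) = - (fps_X ^ nat k * theta_coeff (k - 1))"
      using assms theta_coeff_rec(1)[of "k - 1"] by (simp add: algebra_simps)
    have a2: "partial_theta_int (- 2) = 1 - partial_theta_int 1" using partial_theta_int_reflect[of 1] by simp
    show ?thesis using 5 by (simp add: r a2 algebra_simps)
  next
    case 6
    have "nat k = Suc (nat (k - 1))" using assms by simp
    then have "fps_X ^ nat k * theta_coeff (k - 2) = - (fps_X * theta_coeff (k + 1))"
      using assms theta_coeff_rec(1)[of "k - 2"] by (simp add: algebra_simps)
    then have "fps_X ^ nat k * (theta_coeff (k - 2) * partial_theta_int 2) = - (theta_coeff (k + 1) *
        (fps_X * partial_theta_int 2))"
      by (metis (no_types, lifting) mult.assoc mult.commute mult_minus_left)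
    also have "fps_X * partial_theta_int 2 = partial_theta_int 0 -
        pentagonal_series" using partial_theta_pentagonal by (simp add: partial_theta_int_def algebra_simps)
    finally have r: "fps_X ^ nat k * (theta_coeff (k - 2) * partial_theta_int 2) = - (theta_coeff (k +
        1) * (partial_theta_int 0 - pentagonal_series))" .
    have a1: "partial_theta_int (- 1) = 1 - partial_theta_int 0" using partial_theta_int_reflect[of 0] by simp
    show ?thesis using 6 by (simp add: r a1) (simp add: algebra_simps)
  qed
qed

text \<open>In the sum over all j the shift by 3 disappears. The -1 next to
  \<open>partial_theta_int\<close> adds up to - R(1) = - 2 P, which is the 2 on the right.\<close>

lemma theta_conv_eq:
  assumes "k \<ge> 1"
  shows "(1 - fps_X ^ nat k) * theta_conv k = pentagonal_series * (2 - fps_X ^ nat k * theta_coeff k -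
      theta_coeff (k + 1))"
proof -
  let ?D = "\<lambda>j. if j = 0 then fps_X ^ nat k * theta_coeff k else if j = (2::int) then
      theta_coeff (k + 1) else 0"
  have D: "locally_finite ?D" by (rule locally_finite_finite[of "{0, 2}"]) auto
  have lf: "locally_finite (\<lambda>j. theta_coeff (k + 3 - j) * (partial_theta_int (j - 3) - 1))"
    by (rule locally_finite_theta_coeff_reflect)
  have "fps_X ^ nat k * theta_conv k = fps_Sum (\<lambda>j. fps_X ^ nat k * (theta_coeff (k - j) *
      partial_theta_int j))"
    unfolding theta_conv_def by (rule fps_Sum_mult_left[OF locally_finite_theta_coeff_reflect, symmetric])
  also have "\<dots> = fps_Sum (\<lambda>j. theta_coeff (k + 3 - j) * (partial_theta_int (j - 3) - 1) +
      pentagonal_series * ?D j)"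
    by (rule fps_Sum_cong) (rule theta_conv_term_rec[OF assms])
  also have "\<dots> = fps_Sum (\<lambda>j. theta_coeff (k + 3 - j) * (partial_theta_int (j - 3) - 1)) +
      pentagonal_series * fps_Sum ?D"
    by (simp only: fps_Sum_add[OF lf locally_finite_mult(2)[OF D]] fps_Sum_mult_left[OF D])
  also have "fps_Sum ?D = fps_X ^ nat k * theta_coeff k + theta_coeff (k + 1)"
    by (subst fps_Sum_eq_sum[of "{0, 2}"]) auto
  also have "fps_Sum (\<lambda>j. theta_coeff (k + 3 - j) * (partial_theta_int (j - 3) - 1)) = fps_Sum
      (\<lambda>j. theta_coeff (k + 3 - (j + 3)) * (partial_theta_int (j + 3 - 3) - 1))"
    using fps_Sum_reindex[OF bij_int_shift, of "\<lambda>j. theta_coeff (k + 3 - j) * (partial_theta_int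
        (j - 3) - 1)" 3] by simp
  also have "\<dots> = fps_Sum (\<lambda>j. theta_coeff (k - j) * partial_theta_int j - theta_coeff (k -
      j) * 1)"
    by (rule fps_Sum_cong) (simp add: algebra_simps)
  also have "\<dots> = theta_conv k - 2 * pentagonal_series"
    unfolding theta_conv_def fps_Sum_diff[OF locally_finite_theta_coeff_reflect locally_finite_theta_coeff_reflect]
    by (simp add: sum_theta_coeff_reflect)
  finally show ?thesis by (simp add: algebra_simps)
qed

section \<open>Evaluation at x = -1\<close>

lemma fps_Sum_int_Suc:
  fixes F :: "int \<Rightarrow> 'a::comm_ring_1 fps"
  assumes "locally_finite F"
  shows "fps_Sum F = F 0 + fps_Sum (\<lambda>n. F (int (Suc n)) + F (- int (Suc n)))"
proof -
  have p: "locally_finite (\<lambda>n. F (int n))" and ps: "locally_finite (\<lambda>n. F (int (Suc n)))"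
    and m: "locally_finite (\<lambda>n. F (- int (Suc n)))"
    by (rule locally_finite_inj[OF assms], simp add: inj_def)+
  have "fps_Sum F = fps_Sum (\<lambda>n. F (int n)) + fps_Sum (\<lambda>n. F (- 1 - int n))"
    by (rule fps_Sum_int_split[OF assms])
  also have "fps_Sum (\<lambda>n. F (int n)) = F 0 + fps_Sum (\<lambda>n. F (int (Suc n)))"
    by (subst fps_Sum_nat_Suc[OF p]) simp
  also have "fps_Sum (\<lambda>n. F (- 1 - int n)) = fps_Sum (\<lambda>n. F (- int (Suc n)))"
    by (rule fps_Sum_cong) (simp add: algebra_simps)
  finally show ?thesis by (simp only: fps_Sum_add[OF ps m] add.assoc)
qed

text \<open>The coefficients of (1 - x) A(x), in which the pole at x = 1 is removed, so that they form a locally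
  finite family and evaluation at x = -1 makes sense.\<close>

definition partial_theta_diff :: "int \<Rightarrow> real fps" where
  "partial_theta_diff j = partial_theta_int j - partial_theta_int (j - 1)"

lemma partial_theta_diff_reflect: "partial_theta_diff (- j) = partial_theta_diff j"
proof -
  have "partial_theta_int (- j) = 1 - partial_theta_int (j - 1)" using partial_theta_int_reflect[of "j -
      1"] by simp
  moreover have "partial_theta_int (- j - 1) = 1 - partial_theta_int
      j" using partial_theta_int_reflect[of j] by (metis minus_diff_commute)
  ultimately show ?thesis by (simp add: partial_theta_diff_def)
qed

lemma partial_theta_diff_Suc: "partial_theta_diff (int (Suc j)) = partial_theta (Suc j) - partial_theta j"
  by (simp add: partial_theta_diff_def partial_theta_int_def nat_add_distrib Suc_nat_eq_nat_zadd1)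

text \<open>The shift recurrence shows that \<open>partial_theta i\<close> is 1 modulo q^(i+2).
  Hence consecutive differences form a locally finite family although the partial theta functions do
  not.\<close>

lemma partial_theta_nth: "N < i + 2 \<Longrightarrow> fps_nth (partial_theta i) N = fps_nth 1 N"
proof -
  assume "N < i + 2"
  have "partial_theta i = 1 - fps_X ^ (i + 2) * partial_theta (i + 3)"
    unfolding partial_theta_rec by simp
  then have "fps_nth (partial_theta i) N = fps_nth (1 - fps_X ^ (i + 2) * partial_theta (i + 3))
      N" by (rule arg_cong)
  with \<open>N < i + 2\<close> show ?thesis
    by (simp only: fps_sub_nth fps_X_power_mult_nth) simp
qed

lemma locally_finite_partial_theta_diff: "locally_finite partial_theta_diff"
proof (rule locally_finiteI)
  fix N
  have *: "fps_nth (partial_theta_diff (int (Suc j))) N = 0" if "j \<ge> N" for j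
    using that unfolding partial_theta_diff_Suc by (simp add: partial_theta_nth)
  have "j \<in> {- int N..int N}" if "fps_nth (partial_theta_diff j) N \<noteq> 0" for j
  proof (rule ccontr)
    assume "j \<notin> {- int N..int N}"
    then have "\<bar>j\<bar> > int N" by (auto simp: abs_if)
    then have "\<bar>j\<bar> = int (Suc (nat \<bar>j\<bar> - 1))" and i: "nat \<bar>j\<bar> - 1 \<ge>
        N" by simp_all
    moreover have "partial_theta_diff \<bar>j\<bar> = partial_theta_diff j" by (cases "j \<ge>
        0") (simp_all add: partial_theta_diff_reflect)
    ultimately have "partial_theta_diff j = partial_theta_diff (int (Suc (nat \<bar>j\<bar> - 1)))" by metis
    with *[OF i] that show False by simp
  qed
  then have "{j. fps_nth (partial_theta_diff j) N \<noteq> 0} \<subseteq> {- int N..int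
      N}" by (intro subsetI) (simp only: mem_Collect_eq)
  then show "finite {j. fps_nth (partial_theta_diff j) N \<noteq> 0}" by (rule finite_subset) simp
qed

lemma locally_finite_geometric: "locally_finite (\<lambda>j. alt (int j) * fps_X ^ (Suc n * j))"
proof (rule locally_finite_X_power)
  fix N
  have "{j. Suc n * j \<le> N} \<subseteq> {..N}"
    by (auto intro: le_trans)
  then show "finite {j. Suc n * j \<le> N}"
    by (rule finite_subset) simp
qed

lemma geometric_alternating:
  "fps_Sum (\<lambda>j. alt (int j) * fps_X ^ (Suc n * j)) = inverse (1 + fps_X ^ Suc n)" (is "?G = _")
proof -
  note lf = locally_finite_geometric[of n]
  have "?G = 1 + fps_Sum (\<lambda>j. alt (int (Suc j)) * fps_X ^ (Suc n * Suc j))"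
    by (subst fps_Sum_nat_Suc[OF lf]) simp
  also have "fps_Sum (\<lambda>j. alt (int (Suc j)) * fps_X ^ (Suc n * Suc j))
      = fps_Sum (\<lambda>j. - (fps_X ^ Suc n) * (alt (int j) * fps_X ^ (Suc n * j)))"
    by (rule fps_Sum_cong) (simp add: power_add mult_ac)
  also have "\<dots> = - (fps_X ^ Suc n) * ?G" by (rule fps_Sum_mult_left[OF lf])
  finally have "(1 + fps_X ^ Suc n) * ?G = 1" by (simp add: algebra_simps)
  then show ?thesis by (metis fps_inverse_unique)
qed

definition pent_term :: "nat \<Rightarrow> real fps" where
  "pent_term n = alt (int (Suc n)) * fps_X ^ pent (Suc n)"

lemma locally_finite_pent_term: "locally_finite (\<lambda>n. pent_term n * c n)"
proof -
  have "locally_finite (\<lambda>n. alt (int n) * fps_X ^ (pent n + n * 0))"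
    by (rule locally_finite_partial_theta)
  from locally_finite_inj[OF this inj_Suc] have "locally_finite pent_term"
    by (rule back_subst[of locally_finite]) (simp add: pent_term_def fun_eq_iff)
  then show ?thesis by (rule locally_finite_mult(1))
qed

lemma watson_series_expand: "watson_series = 1 + fps_Sum (\<lambda>n. pent_term n * (4 * inverse (1 +
    fps_X ^ Suc n)))"
proof -
  have "watson_coeff 0 = 1" using watson_coeff_mult[of 0] by (simp add: tri_def)
  moreover have "watson_coeff (int (Suc n)) * fps_X ^ nat ((int (Suc n))\<^sup>2) = pent_term n * (2 *
      inverse (1 + fps_X ^ Suc n))" for n
  proof -
    have "int (2 * (tri (int (Suc n) + 1) + nat ((int (Suc n))\<^sup>2))) = int (2 * pent (Suc n))"
      using int_tri[of "int (Suc n) + 1"] arg_cong[OF double_pent[of "Suc n"], of int]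
      by (simp add: algebra_simps power2_eq_square)
    then have "tri (int (Suc n) + 1) + nat ((int (Suc n))\<^sup>2) = pent (Suc n)"
      unfolding of_nat_eq_iff by (simp only: mult_cancel_left) simp
    then have "fps_X ^ tri (int (Suc n) + 1) * fps_X ^ nat ((int (Suc n))\<^sup>2) = (fps_X ^ pent (Suc
        n) :: real fps)"
      by (metis power_add)
    moreover have "\<bar>int (Suc n)\<bar> = int (Suc n)" "nat (int (Suc n)) = Suc n" by simp_all
    ultimately show ?thesis
      unfolding watson_coeff_def pent_term_def by (simp only: mult_ac)
  qed
  moreover have "watson_coeff (- r) * fps_X ^ nat ((- r)\<^sup>2) = watson_coeff r * fps_X ^ nat
      (r\<^sup>2)" for r
    by (simp add: watson_coeff_def)
  ultimately show ?thesis
    unfolding watson_series_def by (subst fps_Sum_int_Suc[OF locally_finite_square])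
      (simp add: algebra_simps del: of_nat_Suc power_Suc)
qed

text \<open>After interchanging the sums, the sum over j is a geometric series at x = -1 for each n,
  and the difference of consecutive partial theta functions contributes 1 - q^(n+1).\<close>

lemma sum_alt_partial_theta_diff:
  "fps_Sum (\<lambda>j. alt (int (Suc j)) * partial_theta_diff (int (Suc j)))
    = fps_Sum (\<lambda>n. pent_term n * ((1 - fps_X ^ Suc n) * inverse (1 + fps_X ^ Suc n)))"
proof -
  define H where "H j n = pent_term n * ((1 - fps_X ^ Suc n) * (alt (int j) * fps_X ^ (Suc n * j)))" for j n
  have lf: "locally_finite (\<lambda>(j, n). H j n)"
  proof -
    have "{p. (case p of (j, n) \<Rightarrow> pent (Suc n) + Suc n * j) \<le> N} \<subseteq> {..N}
        \<times> {..N}" for N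
    proof clarify
      fix j n assume *: "pent (Suc n) + Suc n * j \<le> N"
      have "Suc n * 2 \<le> 2 * pent (Suc n)" unfolding double_pent by (rule mult_le_mono2) simp
      then have "n \<le> pent (Suc n)" by simp
      with add_leD1[OF *] have "n \<le> N" by (rule order_trans[rotated])
      moreover have "j \<le> N" using add_leD2[OF *] by simp
      ultimately show "j \<in> {..N} \<and> n \<in> {..N}" by simp
    qed
    then have "finite {p. (case p of (j, n) \<Rightarrow> pent (Suc n) + Suc n * j) \<le> N}" for N
      by (rule finite_subset) simp
    from locally_finite_X_power[OF this, of "\<lambda>(j, n). alt (int (Suc n)) * (1 - fps_X ^ Suc n) *
        alt (int j)"]
    show ?thesis
      by (rule back_subst[of locally_finite]) (auto simp: H_def pent_term_def power_add mult_ac)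
  qed
  have "alt (int (Suc j)) * partial_theta_diff (int (Suc j)) = fps_Sum (\<lambda>n. H j n)" for j
  proof -
    have "partial_theta_diff (int (Suc j)) = fps_Sum (\<lambda>n. alt (int n) * fps_X ^ (pent n + n *
        Suc j) - alt (int n) * fps_X ^ (pent n + n * j))"
      unfolding partial_theta_diff_Suc partial_theta_def by (rule fps_Sum_diff[OF locally_finite_partial_theta locally_finite_partial_theta, symmetric])
    also have "\<dots> = fps_Sum (\<lambda>n. alt (int (Suc n)) * fps_X ^ (pent (Suc n) + Suc n * Suc j)
        - alt (int (Suc n)) * fps_X ^ (pent (Suc n) + Suc n * j))"
      by (subst fps_Sum_nat_Suc[OF locally_finite_diff[OF locally_finite_partial_theta locally_finite_partial_theta]]) simp
    finally have b: "partial_theta_diff (int (Suc j)) = fps_Sum (\<lambda>n. alt (int (Suc n)) * fps_X ^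
        (pent (Suc n) + Suc n * Suc j) - alt (int (Suc n)) * fps_X ^ (pent (Suc n) + Suc n * j))" .
    have "locally_finite (\<lambda>n. alt (int (Suc n)) * fps_X ^ (pent (Suc n) + Suc n * Suc j) - alt
        (int (Suc n)) * fps_X ^ (pent (Suc n) + Suc n * j))"
      by (rule locally_finite_inj[OF locally_finite_diff[OF locally_finite_partial_theta locally_finite_partial_theta] inj_Suc])
    then have "alt (int (Suc j)) * partial_theta_diff (int (Suc j)) = fps_Sum (\<lambda>n. alt (int (Suc
        j)) * (alt (int (Suc n)) * fps_X ^ (pent (Suc n) + Suc n * Suc j) - alt (int (Suc n)) * fps_X ^
        (pent (Suc n) + Suc n * j)))"
      unfolding b by (rule fps_Sum_mult_left[symmetric])
    also have "\<dots> = fps_Sum (\<lambda>n. H j n)"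
    proof (rule fps_Sum_cong)
      fix n
      have *: "pent (Suc n) + Suc n * Suc j = pent (Suc n) + (Suc n * j + Suc n)" by simp
      have "alt (int (Suc j)) = - alt (int j)" by simp
      then show "alt (int (Suc j)) * (alt (int (Suc n)) * fps_X ^ (pent (Suc n) + Suc n * Suc j) - alt
          (int (Suc n)) * fps_X ^ (pent (Suc n) + Suc n * j)) = H j n"
        unfolding * power_add H_def pent_term_def by (simp add: algebra_simps del: power_Suc of_nat_Suc mult_Suc)
    qed
    finally show ?thesis .
  qed
  then have "fps_Sum (\<lambda>j. alt (int (Suc j)) * partial_theta_diff (int (Suc j))) = fps_Sum
      (\<lambda>j. fps_Sum (\<lambda>n. H j n))"
    by (rule fps_Sum_cong)
  also have "\<dots> = fps_Sum (\<lambda>n. fps_Sum (\<lambda>j. H j n))"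
    by (rule fps_Sum_swap[OF lf])
  also have "\<dots> = fps_Sum (\<lambda>n. pent_term n * ((1 - fps_X ^ Suc n) * inverse (1 + fps_X ^
      Suc n)))"
  proof (rule fps_Sum_cong)
    fix n
    note lf = locally_finite_geometric[of n]
    show "fps_Sum (\<lambda>j. H j n) = pent_term n * ((1 - fps_X ^ Suc n) * inverse (1 + fps_X ^ Suc n))"
      unfolding H_def geometric_alternating[symmetric]
      by (simp only: fps_Sum_mult_left[OF lf] fps_Sum_mult_left[OF locally_finite_mult(2)[OF lf]])
  qed
  finally show ?thesis .
qed

text \<open>The right side is (1 - x) A(x) at x = -1, that is 2 A(-1). With g = 1/(1 + q^(n+1)) the
  terms match because 1 + (1 - q^(n+1)) g = 2 g.\<close>

lemma watson_series_eq: "watson_series = fps_Sum (\<lambda>j. alt j * partial_theta_diff j)"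
proof -
  let ?c = "\<lambda>n. (1 - fps_X ^ Suc n) * inverse (1 + fps_X ^ Suc n) :: real fps"
  have lf: "locally_finite (\<lambda>j. alt j * partial_theta_diff j)"
    by (rule locally_finite_mult(2)[OF locally_finite_partial_theta_diff])
  have lfs: "locally_finite (\<lambda>n. alt (int (Suc n)) * partial_theta_diff (int (Suc n)))"
    by (rule locally_finite_inj[OF lf]) (simp add: inj_def)
  have "partial_theta 0 = 1 + fps_Sum (\<lambda>n. pent_term n * 1)"
    unfolding partial_theta_def by (subst fps_Sum_nat_Suc[OF locally_finite_partial_theta]) (simp add: pent_def[of 0] pent_term_def)
  then have b0: "partial_theta_diff 0 = 1 + 2 * fps_Sum (\<lambda>n. pent_term n * 1)"
    by (simp add: partial_theta_diff_def partial_theta_int_def)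
  have "fps_Sum (\<lambda>j. alt j * partial_theta_diff j) = partial_theta_diff 0 + fps_Sum (\<lambda>n.
      2 * (alt (int (Suc n)) * partial_theta_diff (int (Suc n))))"
    by (subst fps_Sum_int_Suc[OF lf]) (simp add: partial_theta_diff_reflect[of "1 + int
        _"] partial_theta_diff_reflect del: of_nat_Suc)
  also have "\<dots> = partial_theta_diff 0 + 2 * fps_Sum (\<lambda>n. pent_term n * ?c n)"
    by (simp only: fps_Sum_mult_left[OF lfs] sum_alt_partial_theta_diff)
  also have "\<dots> = 1 + 2 * fps_Sum (\<lambda>n. pent_term n * 1 + pent_term n * ?c n)"
    unfolding b0 fps_Sum_add[OF locally_finite_pent_term locally_finite_pent_term] by (simp add: algebra_simps)
  also have "\<dots> = 1 + fps_Sum (\<lambda>n. 2 * (pent_term n * 1 + pent_term n * ?c n))"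
    by (subst fps_Sum_mult_left[OF locally_finite_add[OF locally_finite_pent_term locally_finite_pent_term]]) (rule refl)
  also have "fps_Sum (\<lambda>n. 2 * (pent_term n * 1 + pent_term n * ?c n)) = fps_Sum (\<lambda>n.
      pent_term n * (4 * inverse (1 + fps_X ^ Suc n)))"
  proof (rule fps_Sum_cong)
    fix n
    define g :: "real fps" where "g = inverse (1 + fps_X ^ Suc n)"
    have "(1 + fps_X ^ Suc n) * g = 1"
      unfolding g_def by (rule inverse_mult_eq_1') simp
    then have "1 + (1 - fps_X ^ Suc n) * g = 2 * g" by (simp add: algebra_simps)
    then have "pent_term n * (1 + (1 - fps_X ^ Suc n) * g) = pent_term n * (2 * g)" by (rule arg_cong)
    then show "2 * (pent_term n * 1 + pent_term n * ?c n) = pent_term n * (4 * inverse (1 + fps_X ^ Suc n))"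
      unfolding g_def[symmetric] by (simp add: distrib_left mult.left_commute del: power_Suc)
  qed
  finally show ?thesis unfolding watson_series_expand ..
qed

lemma theta_conv_diff: "theta_conv k - theta_conv (k - 1) = fps_Sum (\<lambda>j. theta_coeff (k - j) *
    partial_theta_diff j)"
proof -
  have "theta_conv (k - 1) = fps_Sum (\<lambda>j. theta_coeff (k - 1 - (j + - 1)) * partial_theta_int (j
      + - 1))"
    unfolding theta_conv_def using fps_Sum_reindex[OF bij_int_shift, of "\<lambda>j. theta_coeff (k - 1
        - j) * partial_theta_int j" "- 1"] by simp
  also have "\<dots> = fps_Sum (\<lambda>j. theta_coeff (k - j) * partial_theta_int (j - 1))" by simp
  finally have "theta_conv k - theta_conv (k - 1) = fps_Sum (\<lambda>j. theta_coeff (k - j) *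
      partial_theta_int j - theta_coeff (k - j) * partial_theta_int (j - 1))"
    unfolding theta_conv_def by (simp only: fps_Sum_diff[OF locally_finite_theta_coeff_reflect locally_finite_theta_coeff_reflect])
  then show ?thesis by (simp only: partial_theta_diff_def right_diff_distrib)
qed

text \<open>Pairing the coefficients of G(x) = (1 - x) E(x) with these weights gives 2 G'(-1) + G(-1) =
  4 E'(-1): the value E(-1), which vanishes, drops out.\<close>

definition conv_weight :: "int \<Rightarrow> real fps" where
  "conv_weight k = - alt k * of_int (2 * k - 1)"

lemma alt_add: "alt (k + l) = alt k * alt l"
  by (simp add: alt_def)

text \<open>The weight at k = l + j splits into a part linear in l and a part with 2j - 1. The
  second one multiplies R(-1) = 0; the first one gives 2 R'(-1) S.\<close>

lemma theta_watson_convolution: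
  shows "locally_finite (\<lambda>k. conv_weight k * (theta_conv k - theta_conv (k - 1)))"
    and "fps_Sum (\<lambda>k. conv_weight k * (theta_conv k - theta_conv (k - 1))) = 2 * (theta *
        watson_series)"
proof -
  define A where "A l = of_int l * alt l * theta_coeff l" for l
  define B where "B j = alt j * partial_theta_diff j" for j
  define C where "C l = alt l * theta_coeff l" for l
  define D where "D j = of_int (2 * j - 1) * alt j * partial_theta_diff j" for j
  have A: "locally_finite A" and C: "locally_finite C"
    unfolding A_def C_def by (rule locally_finite_mult(2)[OF locally_finite_theta_coeff])+
  have B: "locally_finite B" and D: "locally_finite D"
    unfolding B_def D_def by (rule locally_finite_mult(2)[OF locally_finite_partial_theta_diff])+
  define H where "H = (\<lambda>(l, j). conv_weight (l + j) * (theta_coeff l * partial_theta_diff j))"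
  have H: "H p = (- 2) * (case p of (l, j) \<Rightarrow> A l * B j) - (case p of (l, j) \<Rightarrow> C
      l * D j)" for p
    by (cases p) (simp add: H_def conv_weight_def A_def B_def C_def D_def alt_add algebra_simps)
  have lf1: "locally_finite (\<lambda>(l, j). A l * B j)" and lf2: "locally_finite (\<lambda>(l, j). C l
      * D j)"
    by (rule locally_finite_product[OF A B], rule locally_finite_product[OF C D])
  have lfH: "locally_finite H"
    unfolding H by (rule locally_finite_diff[OF locally_finite_mult(2)[OF lf1] lf2])
  have "fps_Sum H = (- 2) * (fps_Sum A * fps_Sum B) - fps_Sum C * fps_Sum D"
    unfolding H fps_Sum_diff[OF locally_finite_mult(2)[OF lf1] lf2] fps_Sum_mult_left[OF lf1]
    by (simp only: fps_Sum_product[OF A B] fps_Sum_product[OF C D])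
  also have "fps_Sum A = - theta" unfolding theta_eq A_def by simp
  also have "fps_Sum B = watson_series" unfolding watson_series_eq B_def ..
  also have "fps_Sum C = 0" unfolding C_def by (rule sum_alt_theta_coeff)
  finally have sumH: "fps_Sum H = 2 * (theta * watson_series)" by simp
  define h where "h = (\<lambda>(k, j). (k - j, j) :: int \<times> int)"
  have h: "bij h"
    by (rule o_bij[of "\<lambda>(l, j). (l + j, j)"]) (auto simp: h_def)
  have Hh: "H (h (k, j)) = conv_weight k * (theta_coeff (k - j) * partial_theta_diff
      j)" for k j by (simp add: H_def h_def)
  have lf: "locally_finite (\<lambda>(k, j). conv_weight k * (theta_coeff (k - j) * partial_theta_diff j))"
    using locally_finite_inj[OF lfH bij_is_inj[OF h]] by (rule back_subst[of locally_finite]) (auto simp: Hh)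
  have *: "conv_weight k * (theta_conv k - theta_conv (k - 1)) = fps_Sum (\<lambda>j. conv_weight k *
      (theta_coeff (k - j) * partial_theta_diff j))" for k
    unfolding theta_conv_diff by (rule fps_Sum_mult_left[OF locally_finite_theta_coeff_reflect, symmetric])
  show "locally_finite (\<lambda>k. conv_weight k * (theta_conv k - theta_conv (k - 1)))"
    unfolding * by (rule fps_Sum_curry(1)[OF lf])
  have "fps_Sum (\<lambda>k. conv_weight k * (theta_conv k - theta_conv (k - 1))) = fps_Sum
      (\<lambda>(k, j). conv_weight k * (theta_coeff (k - j) * partial_theta_diff j))"
    unfolding * by (rule fps_Sum_curry(2)[OF lf])
  also have "\<dots> = fps_Sum (\<lambda>p. H (h p))"
    by (rule fps_Sum_cong) (auto simp: Hh)
  also have "\<dots> = 2 * (theta * watson_series)"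
    using fps_Sum_reindex[OF h, of H] sumH by simp
  finally show "fps_Sum (\<lambda>k. conv_weight k * (theta_conv k - theta_conv (k - 1))) = 2 * (theta *
      watson_series)" .
qed

definition conv_term :: "nat \<Rightarrow> real fps" where
  "conv_term n = alt (int n) * of_nat (2 * n + 1) * (theta_conv (int (Suc n)) - theta_conv (int n))"

text \<open>The weighted coefficients of (1 - x) E are invariant under k -> 1 - k, so the indices k
  >= 1 contribute exactly half of the sum.\<close>

lemma theta_watson_sum:
  shows "locally_finite conv_term" and "theta * watson_series = fps_Sum conv_term"
proof -
  define F where "F k = conv_weight k * (theta_conv k - theta_conv (k - 1))" for k
  have lf: "locally_finite F" unfolding F_def by (rule theta_watson_convolution)
  have lfs: "locally_finite (\<lambda>k. F (k + 1))"
    by (rule locally_finite_inj[OF lf]) (simp add: inj_def)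
  have refl: "F (1 - k) = F k" for k
  proof -
    have "theta_conv (1 - k) = 2 * pentagonal_series - theta_conv (k -
        1)" using theta_conv_reflect[of "k - 1"] by simp
    moreover have "theta_conv (1 - k - 1) = 2 * pentagonal_series - theta_conv
        k" using theta_conv_reflect[of k] by simp
    moreover have "conv_weight (1 - k) = conv_weight k" by (simp add: conv_weight_def algebra_simps)
    ultimately show ?thesis unfolding F_def by simp
  qed
  have wd: "F (int n + 1) = conv_term n" for n
    by (simp add: F_def conv_weight_def conv_term_def algebra_simps)
  have inj: "inj (\<lambda>n. int n + 1)" by (simp add: inj_def)
  show lfwd: "locally_finite conv_term"
    using locally_finite_inj[OF lf inj] by (simp add: wd)
  have "2 * (theta * watson_series) = fps_Sum F"
    unfolding F_def theta_watson_convolution(2) ..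
  also have "\<dots> = fps_Sum (\<lambda>k. F (k + 1))"
    using fps_Sum_reindex[OF bij_int_shift, of F 1] by simp
  also have "\<dots> = fps_Sum (\<lambda>n. F (int n + 1)) + fps_Sum (\<lambda>n. F (- 1 - int n + 1))"
    by (rule fps_Sum_int_split[OF lfs])
  also have "fps_Sum (\<lambda>n. F (int n + 1)) = fps_Sum conv_term"
    by (rule fps_Sum_cong) (rule wd)
  also have "fps_Sum (\<lambda>n. F (- 1 - int n + 1)) = fps_Sum conv_term"
  proof (rule fps_Sum_cong)
    fix n
    show "F (- 1 - int n + 1) = conv_term n"
      using refl[of "int n + 1"] wd[of n] by simp
  qed
  finally have "2 * (theta * watson_series) = 2 * fps_Sum conv_term" by simp
  then show "theta * watson_series = fps_Sum conv_term" by simp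
qed

section \<open>Passage to Lambert series\<close>

definition lambert_term :: "nat \<Rightarrow> real fps" where
  "lambert_term n = (2 * fps_X ^ Suc n - fps_X ^ Suc n * theta_coeff (int (Suc n)) - theta_coeff (int
      (Suc (Suc n)))) * inverse (1 - fps_X ^ Suc n)"

text \<open>The coefficients of E tend to 2 P, not to 0; splitting off the 2 leaves a locally finite
  family, which can be summed separately.\<close>

lemma theta_conv_Suc: "theta_conv (int (Suc n)) = pentagonal_series * (2 + lambert_term n)"
proof -
  define y where "y = (fps_X ^ Suc n :: real fps)"
  have y: "inverse (1 - y) * (1 - y) = 1"
    unfolding y_def by (rule inverse_mult_eq_1) simp
  have k: "1 \<le> int (Suc n)" "int (Suc n) + 1 = int (Suc (Suc n))" by simp_all
  have "(1 - y) * theta_conv (int (Suc n)) = pentagonal_series * (2 - y * theta_coeff (int (Suc n)) -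
      theta_coeff (int (Suc (Suc n))))"
    using theta_conv_eq[OF k(1)] unfolding y_def nat_int k(2) .
  also have "\<dots> = pentagonal_series * (2 * (inverse (1 - y) * (1 - y)) * (1 - y) + lambert_term n *
      (1 - y))"
    unfolding lambert_term_def y_def[symmetric] mult.assoc y by (simp add: algebra_simps)
  also have "\<dots> = (1 - y) * (pentagonal_series * (2 + lambert_term n))"
    unfolding y by (simp add: algebra_simps)
  finally have "inverse (1 - y) * ((1 - y) * theta_conv (int (Suc n))) = inverse (1 - y) * ((1 - y) *
      (pentagonal_series * (2 + lambert_term n)))"
    by (rule arg_cong)
  then show ?thesis unfolding mult.assoc[symmetric] y by simp
qed

lemma locally_finite_lambert_term: "locally_finite (\<lambda>n. c n * lambert_term n)"
proof -
  have "{n. Suc n \<le> N} \<subseteq> {..N}" for N by auto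
  then have "finite {n. Suc n \<le> N}" for N by (rule finite_subset) simp
  then have l1: "locally_finite (\<lambda>n. (2 - theta_coeff (int (Suc n))) * fps_X ^ Suc n)"
    by (rule locally_finite_X_power)
  have l2: "locally_finite (\<lambda>n. theta_coeff (int (Suc (Suc n))))"
    by (rule locally_finite_inj[OF locally_finite_theta_coeff]) (simp add: inj_def)
  have "locally_finite (\<lambda>n. c n * (((2 - theta_coeff (int (Suc n))) * fps_X ^ Suc n -
      theta_coeff (int (Suc (Suc n)))) * inverse (1 - fps_X ^ Suc n)))"
    by (rule locally_finite_mult(2)[OF locally_finite_mult(1)[OF locally_finite_diff[OF l1 l2]]])
  then show ?thesis
    by (rule back_subst[of locally_finite]) (simp add: lambert_term_def fun_eq_iff algebra_simps)
qed

text \<open>Summation by parts: \<open>lambert_term n\<close> occurs in two consecutive differences,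
  with weights 2n + 1 and 2n + 3 of equal sign, hence 4(n + 1). The leading 1 arises because
  coefficient 0 of E is P instead of 2 P.\<close>

lemma theta_mock_f: "theta * mock_f = 1 + fps_Sum (\<lambda>n. alt (int n) * of_nat (4 * Suc n) *
    lambert_term n)"
proof -
  define A where "A n = alt (int n) * of_nat (2 * n + 1) * lambert_term n" for n
  define B where "B n = alt (int n) * of_nat (2 * n + 3) * lambert_term n" for n
  have A: "locally_finite A" and B: "locally_finite B"
    unfolding A_def B_def by (rule locally_finite_lambert_term)+
  have AS: "locally_finite (\<lambda>n. A (Suc n))" by (rule locally_finite_inj[OF A inj_Suc])
  have "conv_term (Suc n) = pentagonal_series * (A (Suc n) + B n)" for n
    unfolding conv_term_def theta_conv_Suc A_def B_def by (simp add: algebra_simps)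
  then have "fps_Sum (\<lambda>n. conv_term (Suc n)) = fps_Sum (\<lambda>n. pentagonal_series * (A (Suc
      n) + B n))"
    by (rule fps_Sum_cong)
  also have "\<dots> = pentagonal_series * (fps_Sum (\<lambda>n. A (Suc n)) + fps_Sum B)"
    by (simp only: fps_Sum_mult_left[OF locally_finite_add[OF AS B]] fps_Sum_add[OF AS B])
  finally have s: "fps_Sum (\<lambda>n. conv_term (Suc n)) = pentagonal_series * (fps_Sum (\<lambda>n. A
      (Suc n)) + fps_Sum B)" .
  have "conv_term 0 = pentagonal_series * (1 + A 0)"
    unfolding conv_term_def theta_conv_Suc A_def by (simp add: theta_conv_0 algebra_simps)
  then have "theta * watson_series = pentagonal_series * (1 + (A 0 + fps_Sum (\<lambda>n. A (Suc n))) +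
      fps_Sum B)"
    unfolding theta_watson_sum(2) fps_Sum_nat_Suc[OF theta_watson_sum(1)] s by (simp add: algebra_simps)
  also have "A 0 + fps_Sum (\<lambda>n. A (Suc n)) = fps_Sum A"
    by (rule fps_Sum_nat_Suc[OF A, symmetric])
  also have "1 + fps_Sum A + fps_Sum B = 1 + fps_Sum (\<lambda>n. A n + B n)"
    by (simp add: fps_Sum_add[OF A B])
  also have "fps_Sum (\<lambda>n. A n + B n) = fps_Sum (\<lambda>n. alt (int n) * of_nat (4 * Suc n) *
      lambert_term n)"
    by (rule fps_Sum_cong) (simp add: A_def B_def algebra_simps)
  finally have "pentagonal_series * (theta * mock_f) = pentagonal_series * (1 + fps_Sum (\<lambda>n. alt
      (int n) * of_nat (4 * Suc n) * lambert_term n))"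
    unfolding watson_mock_f[symmetric] by (simp only: mult_ac)
  moreover have "pentagonal_series \<noteq> 0" using durfee_mult_pentagonal by auto
  ultimately show ?thesis by simp
qed

subsection \<open>Comparing coefficients\<close>

lemma inverse_one_minus_X_power:
  assumes "k > 0"
  shows "inverse (1 - fps_X ^ k) = (Abs_fps (\<lambda>n. if k dvd n then 1 else 0) :: real fps)"
proof (rule fps_inverse_unique, rule fps_ext)
  fix n
  show "fps_nth ((1 - fps_X ^ k) * Abs_fps (\<lambda>n. if k dvd n then 1 else 0) :: real fps) n =
      fps_nth 1 n"
    using assms by (auto simp: left_diff_distrib fps_X_power_mult_nth dvd_minus_self not_less intro: ccontr)
qed

definition residue_sign :: "nat \<Rightarrow> real" where
  "residue_sign k = (if k mod 3 = 0 then 1 else if k mod 3 = 1 then - 1 else 0)"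

lemma theta_sign_eq_residue_sign: "theta_sign (int k) = fps_const (residue_sign k)"
proof -
  have "int k mod 3 = int (k mod 3)" by (simp add: zmod_int)
  then show ?thesis by (auto simp: theta_sign_def residue_sign_def simp flip: fps_const_neg)
qed

definition lambert_ind :: "nat \<Rightarrow> nat \<Rightarrow> nat \<Rightarrow> real" where
  "lambert_ind N d k = (if d \<le> N \<and> k dvd N - d then 1 else 0)"

lemma nth_X_power_lambert:
  assumes "k > 0"
  shows "fps_nth (fps_X ^ d * inverse (1 - fps_X ^ k)) N = lambert_ind N d k"
  using assms by (simp add: inverse_one_minus_X_power fps_X_power_mult_nth lambert_ind_def)

lemma nth_theta_mock_f_term:
  "fps_nth (alt (int n) * of_nat (4 * Suc n) * lambert_term n) N
    = 4 * real (Suc n) * (2 * (- 1) ^ n * lambert_ind N (Suc n) (Suc n)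
      + residue_sign (Suc n) * lambert_ind N (Suc n + theta_exp (int (Suc n))) (Suc n)
      - residue_sign (Suc (Suc n)) * lambert_ind N (theta_exp (int (Suc (Suc n)))) (Suc n))"
proof -
  define g where "g = (inverse (1 - fps_X ^ Suc n) :: real fps)"
  have a1: "alt (int n) * alt (int (Suc n)) = - 1" and a2: "alt (int n) * alt (int (Suc (Suc n))) = 1"
    by (simp_all add: alt_def)
  have a0: "alt (int n) = fps_const ((- 1) ^ n)"
    by (simp add: alt_def minus_one_power_iff flip: fps_const_neg)
  have 1: "alt (int n) * theta_coeff (int (Suc n)) = - (fps_const (residue_sign (Suc n)) * fps_X ^
      theta_exp (int (Suc n)))"
    unfolding theta_coeff_def mult.assoc[symmetric] a1 theta_sign_eq_residue_sign by simp
  have 2: "alt (int n) * theta_coeff (int (Suc (Suc n))) = fps_const (residue_sign (Suc (Suc n))) *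
      fps_X ^ theta_exp (int (Suc (Suc n)))"
    unfolding theta_coeff_def mult.assoc[symmetric] a2 theta_sign_eq_residue_sign by simp
  have "alt (int n) * lambert_term n = 2 * alt (int n) * (fps_X ^ Suc n * g)
      - alt (int n) * theta_coeff (int (Suc n)) * fps_X ^ Suc n * g - alt (int n) * theta_coeff (int (Suc (Suc n))) * g"
    unfolding lambert_term_def g_def[symmetric] by (simp add: algebra_simps del: power_Suc of_nat_Suc)
  also have "\<dots> = fps_const (2 * (- 1) ^ n) * (fps_X ^ Suc n * g)
      + fps_const (residue_sign (Suc n)) * (fps_X ^ (Suc n + theta_exp (int (Suc n))) * g)
      - fps_const (residue_sign (Suc (Suc n))) * (fps_X ^ theta_exp (int (Suc (Suc n))) * g)"
    unfolding 1 2 unfolding a0 power_add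
    by (simp add: numeral_fps_const algebra_simps del: power_Suc of_nat_Suc)
  finally have *: "alt (int n) * lambert_term n = fps_const (2 * (- 1) ^ n) * (fps_X ^ Suc n * g)
      + fps_const (residue_sign (Suc n)) * (fps_X ^ (Suc n + theta_exp (int (Suc n))) * g)
      - fps_const (residue_sign (Suc (Suc n))) * (fps_X ^ theta_exp (int (Suc (Suc n))) * g)" .
  have "alt (int n) * of_nat (4 * Suc n) * lambert_term n = of_nat (4 * Suc n) * (alt (int n) *
      lambert_term n)"
    by (simp only: mult_ac)
  also have "\<dots> = fps_const (real (4 * Suc n)) * (alt (int n) * lambert_term n)"
    by (simp only: fps_of_nat)
  finally have "fps_nth (alt (int n) * of_nat (4 * Suc n) * lambert_term n) N = real (4 * Suc n) *
      fps_nth (alt (int n) * lambert_term n) N"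
    by (simp only: fps_mult_left_const_nth)
  then show ?thesis
    unfolding * g_def by (simp only: fps_mult_left_const_nth fps_add_nth fps_sub_nth nth_X_power_lambert[OF zero_less_Suc] of_nat_mult of_nat_numeral)
qed

lemma nat_theta_exp:
  assumes "k mod 3 \<noteq> 2"
  shows "6 * theta_exp (int k) + k = k * k"
proof -
  have "int k mod 3 \<noteq> 2" using assms by (metis int_ops(3) of_nat_eq_iff of_nat_numeral zmod_int)
  from int_theta_exp[OF this] have "int (6 * theta_exp (int k) + k) = int (k *
      k)" by (simp add: algebra_simps)
  then show ?thesis by (simp only: of_nat_eq_iff)
qed

text \<open>A pair (a, b) on the right-hand side of the theorem corresponds to the pair formed by |b| and
  3 |a| in increasing order.\<close>

definition wedge_pairs :: "nat \<Rightarrow> (nat \<times> nat) set" where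
  "wedge_pairs N = {(k, c). k * c = 6 * N \<and> (\<exists>j. c = k + 1 + 6 * j \<or> c = k + 5 + 6 * j)}"

text \<open>Multiplying N = d + k j by 6 completes it to the factorisation 6 N = k (k + r + 6
  j).\<close>

lemma lambert_ind_eq:
  assumes "k > 0" "6 * d = k * (k + r)"
  shows "lambert_ind N d k = (if \<exists>j. 6 * N = k * (k + r + 6 * j) then 1 else 0)"
proof -
  have "(d \<le> N \<and> k dvd N - d) \<longleftrightarrow> (\<exists>j. 6 * N = k * (k + r + 6 * j))"
  proof
    assume "d \<le> N \<and> k dvd N - d"
    then obtain j where "N = d + k * j" by (metis dvdE le_add_diff_inverse)
    then have "6 * N = k * (k + r + 6 * j)" using assms(2) by (simp add: algebra_simps)
    then show "\<exists>j. 6 * N = k * (k + r + 6 * j)" ..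
  next
    assume "\<exists>j. 6 * N = k * (k + r + 6 * j)"
    then obtain j where "6 * N = k * (k + r + 6 * j)" ..
    then have "6 * N = 6 * (d + k * j)" using assms(2) by (simp add: algebra_simps)
    then have "N = d + k * j" by simp
    then show "d \<le> N \<and> k dvd N - d" by simp
  qed
  then show ?thesis by (simp add: lambert_ind_def)
qed

text \<open>The exponents k + k(k-1)/6 and (k+1)k/6 belong to r = 5 and r = 1. If 3 divides k, both
  count positively and exclude each other modulo 6. Otherwise one of them has residue sign 0, its
  factorisation is impossible modulo 3, and the other counts negatively.\<close>

lemma wedge_term:
  assumes "k > 0" "N > 0"
  shows "residue_sign k * lambert_ind N (k + theta_exp (int k)) k - residue_sign (Suc k) * lambert_ind N
      (theta_exp (int (Suc k))) k
    = (if \<exists>c. (k, c) \<in> wedge_pairs N then if 3 dvd k then 1 else - 1 else 0)"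
proof -
  define E where "E r \<longleftrightarrow> (\<exists>j. 6 * N = k * (k + r + 6 * j))" for r
  have W: "(\<exists>c. (k, c) \<in> wedge_pairs N) \<longleftrightarrow> E 1 \<or> E 5"
    unfolding wedge_pairs_def mem_Collect_eq prod.case E_def by metis
  have A: "lambert_ind N (k + theta_exp (int k)) k = (if E 5 then 1 else 0)" if "k mod 3 \<noteq> 2"
  proof -
    have "6 * (k + theta_exp (int k)) = k * (k + 5)"
      using nat_theta_exp[OF that] by (simp add: algebra_simps)
    then show ?thesis unfolding E_def by (rule lambert_ind_eq[OF assms(1)])
  qed
  have B: "lambert_ind N (theta_exp (int (Suc k))) k = (if E 1 then 1 else 0)" if "Suc k mod 3 \<noteq> 2"
  proof -
    have "6 * theta_exp (int (Suc k)) = k * (k + 1)"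
      using nat_theta_exp[OF that] by simp
    then show ?thesis unfolding E_def by (rule lambert_ind_eq[OF assms(1)])
  qed
  consider "k mod 3 = 0" | "k mod 3 = 1" | "k mod 3 = 2" by linarith
  then show ?thesis
  proof cases
    case 1
    have "\<not> (E 1 \<and> E 5)"
    proof
      assume "E 1 \<and> E 5"
      then obtain j i where "k * (k + 1 + 6 * j) = k * (k + 5 + 6 * i)" unfolding E_def by metis
      then have "k + 1 + 6 * j = k + 5 + 6 * i" using assms(1) by (simp only: mult_cancel1) simp
      then show False by presburger
    qed
    moreover have "Suc k mod 3 = 1" "3 dvd k" using 1 by presburger+
    ultimately show ?thesis using A B 1 unfolding W by (auto simp: residue_sign_def)
  next
    case 2
    have "\<not> E 1"
    proof
      assume "E 1"
      then obtain j where j: "6 * N = k * (k + 1 + 6 * j)" unfolding E_def ..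
      have "(k + 1 + 6 * j) mod 3 = 2" using 2 by presburger
      with 2 have "6 * N mod 3 = 2" unfolding j by (simp only: mod_mult_eq[symmetric, of k "k + 1 + 6 *
          j"]) simp
      then show False by presburger
    qed
    moreover have "Suc k mod 3 = 2" "\<not> 3 dvd k" using 2 by presburger+
    ultimately show ?thesis using A 2 unfolding W by (auto simp: residue_sign_def)
  next
    case 3
    have "\<not> E 5"
    proof
      assume "E 5"
      then obtain j where j: "6 * N = k * (k + 5 + 6 * j)" unfolding E_def ..
      have "(k + 5 + 6 * j) mod 3 = 1" using 3 by presburger
      with 3 have "6 * N mod 3 = 2" unfolding j by (simp only: mod_mult_eq[symmetric, of k "k + 5 + 6 *
          j"]) simp
      then show False by presburger
    qed
    moreover have "Suc k mod 3 = 0" "\<not> 3 dvd k" using 3 by presburger+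
    ultimately show ?thesis using B 3 unfolding W by (auto simp: residue_sign_def)
  qed
qed

lemma finite_wedge_pairs:
  assumes "N > 0"
  shows "finite (wedge_pairs N)" "fst ` wedge_pairs N \<subseteq> {1..6 * N}" "inj_on fst (wedge_pairs N)"
proof -
  have *: "k \<in> {1..6 * N} \<and> c \<in> {1..6 * N}" if "k * c = 6 * N" for k c
  proof -
    have "0 < k * c" using assms that by simp
    then have "k > 0" "c > 0" by simp_all
    then have "k \<le> k * c" "c \<le> k * c" by simp_all
    with \<open>k > 0\<close> \<open>c > 0\<close> show ?thesis unfolding that by simp
  qed
  then have "wedge_pairs N \<subseteq> {1..6 * N} \<times> {1..6 * N}"
    unfolding wedge_pairs_def by blast
  then show "finite (wedge_pairs N)" "fst ` wedge_pairs N \<subseteq> {1..6 * N}"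
    by (auto intro: finite_subset)
  show "inj_on fst (wedge_pairs N)"
  proof (rule inj_onI)
    fix x y assume x: "x \<in> wedge_pairs N" and y: "y \<in> wedge_pairs N" and e: "fst x = fst y"
    have "fst x * snd x = 6 * N" "fst x * snd y = 6 * N"
      using x y e by (simp_all add: wedge_pairs_def split_def)
    then have "snd x = snd y" using assms by (metis mult_eq_0_iff mult_left_cancel neq0_conv zero_neq_numeral)
    with e show "x = y" by (simp add: prod_eq_iff)
  qed
qed

lemma nth_theta_mock_f:
  assumes "N > 0"
  shows "fps_nth (theta * mock_f) N = 8 * (\<Sum>k | k dvd N. (- 1) ^ (k - 1) * real k)
    + 4 * (\<Sum>(k, c)\<in>wedge_pairs N. if 3 dvd k then real k else - real k)"
proof -
  define \<delta> where "\<delta> k = (if \<exists>c. (k, c) \<in> wedge_pairs N then if 3 dvd k then 1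
      else - 1 else 0 :: real)" for k
  define T where "T k = 4 * real k * (2 * (- 1) ^ (k - 1) * (if k dvd N then 1 else 0) + \<delta> k)" for k
  have T: "fps_nth (alt (int n) * of_nat (4 * Suc n) * lambert_term n) N = T (Suc n)" for n
  proof -
    \<comment> \<open>As N > 0, divisibility already implies Suc n <= N.\<close>
    have "lambert_ind N (Suc n) (Suc n) = (if Suc n dvd N then 1 else 0)"
      using assms dvd_imp_le[of "Suc n" N] unfolding lambert_ind_def dvd_minus_self by auto
    then show ?thesis
      unfolding nth_theta_mock_f_term T_def \<delta>_def wedge_term[OF zero_less_Suc assms, symmetric] by simp
  qed
  \<comment> \<open>The bound 6 N covers both contributions: divisors of N, and left factors of 6
    N.\<close>
  have zero: "T k = 0" if "k \<notin> {1..6 * N}" for k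
  proof -
    have "\<delta> k = 0" using finite_wedge_pairs(2)[OF assms] that unfolding \<delta>_def by force
    moreover have "k = 0 \<or> \<not> k dvd N" using that assms dvd_imp_le[of k N] by auto
    ultimately show ?thesis by (auto simp: T_def)
  qed
  have "fps_nth (theta * mock_f) N = fps_nth (fps_Sum (\<lambda>n. alt (int n) * of_nat (4 * Suc n) *
      lambert_term n)) N"
    unfolding theta_mock_f using assms by simp
  also have "\<dots> = (\<Sum>n\<in>{..<6 * N}. fps_nth (alt (int n) * of_nat (4 * Suc n) * lambert_term
      n) N)"
    by (rule fps_Sum_nth) (simp_all only: T zero finite_lessThan, rule zero, simp)
  also have "\<dots> = (\<Sum>n\<in>{..<6 * N}. T (Suc n))" by (simp only: T)
  also have "\<dots> = (\<Sum>k\<in>{1..6 * N}. T k)"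
    by (rule sum.reindex_bij_witness[of _ "\<lambda>k. k - 1" Suc]) auto
  also have "\<dots> = 8 * (\<Sum>k\<in>{1..6 * N}. if k dvd N then (- 1) ^ (k - 1) * real k else 0) + 4
      * (\<Sum>k\<in>{1..6 * N}. real k * \<delta> k)"
    unfolding sum_distrib_left sum.distrib[symmetric] by (rule sum.cong) (auto simp: T_def algebra_simps)
  also have "(\<Sum>k\<in>{1..6 * N}. if k dvd N then (- 1) ^ (k - 1) * real k else 0) = (\<Sum>k | k
      dvd N. (- 1) ^ (k - 1) * real k)"
  proof -
    have "k \<in> {1..6 * N}" if "k dvd N" for k
      using that assms dvd_imp_le[of k N] by (cases "k = 0") auto
    then have "{k \<in> {1..6 * N}. k dvd N} = {k. k dvd N}" by blast
    then show ?thesis by (simp only: sum.inter_filter[OF finite_atLeastAtMost, symmetric])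
  qed
  also have "(\<Sum>k\<in>{1..6 * N}. real k * \<delta> k) = (\<Sum>k\<in>fst ` wedge_pairs N. real k *
      \<delta> k)"
  proof (rule sum.mono_neutral_right[OF _ finite_wedge_pairs(2)[OF assms]])
    show "\<forall>k\<in>{1..6 * N} - fst ` wedge_pairs N. real k * \<delta> k = 0"
    proof
      fix k assume "k \<in> {1..6 * N} - fst ` wedge_pairs N"
      then have "\<nexists>c. (k, c) \<in> wedge_pairs N" by (metis DiffD2 fst_conv image_eqI)
      then show "real k * \<delta> k = 0" by (simp only: \<delta>_def if_False mult_zero_right)
    qed
  qed simp
  also have "\<dots> = (\<Sum>p\<in>wedge_pairs N. real (fst p) * \<delta> (fst p))"
    by (simp only: sum.reindex[OF finite_wedge_pairs(3)[OF assms]] comp_def)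
  also have "\<dots> = (\<Sum>(k, c)\<in>wedge_pairs N. if 3 dvd k then real k else - real k)"
  proof (rule sum.cong[OF refl])
    fix p assume "p \<in> wedge_pairs N"
    then have "(fst p, snd p) \<in> wedge_pairs N" by simp
    then have "\<exists>c. (fst p, c) \<in> wedge_pairs N" ..
    then have "\<delta> (fst p) = (if 3 dvd fst p then 1 else - 1)" by (simp only: \<delta>_def if_True)
    then show "real (fst p) * \<delta> (fst p) = (case p of (k, c) \<Rightarrow> if 3 dvd k then real k
        else - real k)"
      by (simp add: split_def)
  qed
  finally show ?thesis .
qed

lemma nth_theta_mult:
  "fps_nth (theta * F) N = (\<Sum>m | 3 * m\<^sup>2 + m \<le> 2 * int N.
     real_of_int (6 * m + 1) * fps_nth F (nat (int N - (3 * m\<^sup>2 + m) div 2)))"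
proof -
  let ?e = "\<lambda>m::int. nat ((3 * m\<^sup>2 + m) div 2)"
  have e: "2 * int (?e m) = 3 * m\<^sup>2 + m" for m
  proof -
    have "0 \<le> m * (3 * m + 1)"
      by (cases "m \<ge> 0") (auto intro: mult_nonpos_nonpos)
    then have "0 \<le> 3 * m\<^sup>2 + m" by (simp add: power2_eq_square algebra_simps)
    moreover have "even (3 * m\<^sup>2 + m)" by simp
    ultimately show ?thesis by simp
  qed
  then have le: "?e m \<le> M \<longleftrightarrow> 3 * m\<^sup>2 + m \<le> 2 * int M" for m M
    by (metis mult_le_cancel_left_pos of_nat_le_iff zero_less_numeral)
  have lf: "locally_finite (\<lambda>m. of_int (6 * m + 1) * fps_X ^ ?e m :: real fps)"
    by (rule locally_finite_X_power) (simp only: le finite_left_index)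
  have c: "fps_nth (of_int (6 * m + 1) * fps_X ^ ?e m * F) N
      = (if ?e m \<le> N then real_of_int (6 * m + 1) * fps_nth F (N - ?e m) else 0)" for m
    unfolding fps_of_int[symmetric] mult.assoc by (simp add: fps_X_power_mult_nth not_less[symmetric] del: of_int_add of_int_mult)
  have "fps_nth (theta * F) N = (\<Sum>m | 3 * m\<^sup>2 + m \<le> 2 * int N. fps_nth (of_int (6 * m +
      1) * fps_X ^ ?e m * F) N)"
    unfolding theta_def fps_Sum_mult_right[OF lf, symmetric]
  proof (rule fps_Sum_nth[OF finite_left_index])
    fix m :: int assume "m \<notin> {m. 3 * m\<^sup>2 + m \<le> 2 * int N}"
    then have "\<not> ?e m \<le> N" unfolding le mem_Collect_eq .
    then show "fps_nth (of_int (6 * m + 1) * fps_X ^ ?e m * F) N = 0" by (simp only: c if_False)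
  qed
  also have "\<dots> = (\<Sum>m | 3 * m\<^sup>2 + m \<le> 2 * int N.
     real_of_int (6 * m + 1) * fps_nth F (nat (int N - (3 * m\<^sup>2 + m) div 2)))"
  proof (rule sum.cong[OF refl])
    fix m :: int assume "m \<in> {m. 3 * m\<^sup>2 + m \<le> 2 * int N}"
    then have eN: "?e m \<le> N" by (simp only: le mem_Collect_eq)
    define d where "d = ?e m"
    have x: "3 * m\<^sup>2 + m = 2 * int d" unfolding d_def by (rule e[symmetric])
    have d: "(3 * m\<^sup>2 + m) div 2 = int d" unfolding x by simp
    have "int N - int d = int (N - d)" using eN unfolding d_def by (simp only: of_nat_diff)
    then show "fps_nth (of_int (6 * m + 1) * fps_X ^ ?e m * F) N
      = real_of_int (6 * m + 1) * fps_nth F (nat (int N - (3 * m\<^sup>2 + m) div 2))"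
      unfolding c if_P[OF eN] unfolding d by (simp only: nat_int)
  qed
  finally show ?thesis .
qed

section \<open>Divisor sums\<close>

lemma divisor_sigma_nat:
  assumes "n > 0"
  shows "divisor_sigma (real n) = (\<Sum>d | d dvd n. real d)"
proof -
  have "divisor_sigma (real n) = (\<Sum>d | 0 < d \<and> d dvd int n. real_of_int d)"
    by (simp add: divisor_sigma_def)
  also have "\<dots> = (\<Sum>d | d dvd n. real d)"
    by (rule sum.reindex_bij_witness[of _ int nat]) (use assms in \<open>auto simp: nat_dvd_iff intro: Nat.gr0I\<close>)
  finally show ?thesis .
qed

lemma sum_even_divisors:
  assumes "n > 0"
  shows "(\<Sum>d | d dvd n \<and> even d. real d) = 2 * divisor_sigma (real n / 2)"
proof (cases "even n")
  case True
  then obtain m where m: "n = 2 * m" by (rule evenE)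
  have "(\<Sum>d | d dvd n \<and> even d. real d) = (\<Sum>d | d dvd m. 2 * real d)"
    unfolding m by (rule sum.reindex_bij_witness[of _ "\<lambda>d. 2 * d" "\<lambda>d. d div
        2"]) (auto elim!: evenE)
  also have "\<dots> = 2 * divisor_sigma (real m)"
    using assms m by (simp add: divisor_sigma_nat sum_distrib_left)
  finally show ?thesis by (simp add: m)
next
  case False
  then have "{d. d dvd n \<and> even d} = {}" by (auto dest: dvd_trans)
  moreover have "real n / 2 \<notin> \<int>"
  proof
    assume "real n / 2 \<in> \<int>"
    then obtain z where "real n / 2 = of_int z" by (rule Ints_cases)
    then have "real_of_int (int n) = real_of_int (2 * z)" by simp
    then have "int n = 2 * z" by (simp only: of_int_eq_iff)
    with False show False by presburger
  qed
  ultimately show ?thesis by (simp only: divisor_sigma_def sum.empty if_False mult_zero_right)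
qed

text \<open>Switching the sign of the even divisors subtracts them twice, and they are the doubles
  of the divisors of n/2; this gives the factor 4.\<close>

lemma sum_alternating_divisors:
  assumes "n > 0"
  shows "(\<Sum>d | d dvd n. (- 1) ^ (d - 1) * real d) = divisor_sigma (real n) - 4 * divisor_sigma
      (real n / 2)"
proof -
  have fin: "finite {d. d dvd n}" using assms by simp
  have "(\<Sum>d | d dvd n. (- 1) ^ (d - 1) * real d) = (\<Sum>d | d dvd n. real d - 2 * (if even d then
      real d else 0))"
  proof (rule sum.cong[OF refl])
    fix d assume "d \<in> {d. d dvd n}"
    then have "d > 0" using assms by (auto intro: Nat.gr0I)
    then obtain i where "d = Suc i" by (auto simp: gr0_conv_Suc)
    then show "(- 1) ^ (d - 1) * real d = real d - 2 * (if even d then real d else 0)"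
      by (auto simp: minus_one_power_iff)
  qed
  also have "\<dots> = (\<Sum>d | d dvd n. real d) - 2 * (\<Sum>d | d dvd n. if even d then real d else 0)"
    by (simp only: sum_subtractf sum_distrib_left)
  also have "(\<Sum>d | d dvd n. if even d then real d else 0) = (\<Sum>d | d dvd n \<and> even d. real d)"
    using sum.inter_filter[OF fin, of real even] by simp
  finally show ?thesis using assms by (simp add: divisor_sigma_nat sum_even_divisors)
qed

section \<open>The right-hand side as a sum over factorisations\<close>

lemma of_int_div_6_Ints: "(1/6) * real_of_int z \<in> \<int> \<longleftrightarrow> 6 dvd z"
proof
  assume "(1/6) * real_of_int z \<in> \<int>"
  then obtain y where "(1/6) * real_of_int z = of_int y" by (rule Ints_cases)
  then have "real_of_int z = real_of_int (6 * y)" by simp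
  then show "6 dvd z" by (simp only: of_int_eq_iff dvd_triv_left)
next
  assume "6 dvd z"
  then obtain y where "z = 6 * y" by (rule dvdE)
  then show "(1/6) * real_of_int z \<in> \<int>" by simp
qed

lemma N_of_Ints_iff: "N_of a b \<in> \<int> \<longleftrightarrow> 6 dvd b - 3 * a - 1"
  using of_int_div_6_Ints[of "b - 3 * a - 1"] by (simp add: N_of_def algebra_simps)

lemma N_tilde_Ints_iff: "N_tilde a b \<in> \<int> \<longleftrightarrow> 6 dvd b + 3 * a - 1"
  using of_int_div_6_Ints[of "b + 3 * a - 1"] by (simp add: N_tilde_def algebra_simps)

definition rhs_term :: "int \<Rightarrow> int \<Rightarrow> real" where
  "rhs_term a b = sgn_plus (N_of a b) * sgn_plus (N_tilde a b) * (\<bar>N_of a b + 1/6\<bar> -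
      \<bar>N_tilde a b + 1/6\<bar>)"

text \<open>For an integer z, \<open>sgn_plus\<close> gives the sign of z + 1/6, so both signs are
  those of (b - 3a)/6 and (b + 3a)/6. They agree exactly when 3|a| < |b|; equality is impossible
  because 3 does not divide b.\<close>

lemma rhs_term_eq:
  assumes "a * b > 0" "6 dvd b - 3 * a - 1" "6 dvd b + 3 * a - 1"
  shows "rhs_term a b = (if \<bar>b\<bar> < 3 * \<bar>a\<bar> then real_of_int \<bar>b\<bar> / 3 else -
      real_of_int \<bar>a\<bar>)"
proof -
  from assms(2) obtain q where q: "b - 3 * a - 1 = 6 * q" by (rule dvdE)
  from assms(3) obtain p where p: "b + 3 * a - 1 = 6 * p" by (rule dvdE)
  have a: "a = p - q" and b: "b = 3 * p + 3 * q + 1" using p q by linarith+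
  have N: "N_of a b = real_of_int q" "N_tilde a b = real_of_int p"
    unfolding N_of_def N_tilde_def a b by simp_all
  have s: "sgn_plus (real_of_int z) = (if z \<ge> 0 then 1 else - 1)" for z
    by (simp add: sgn_plus_def sgn_if)
  have sign: "a > 0 \<and> b > 0 \<or> a < 0 \<and> b < 0"
    using assms(1) by (simp add: zero_less_mult_iff)
  show ?thesis
    unfolding rhs_term_def N s
    using sign unfolding a b by (auto simp: abs_if field_simps)
qed

definition opposite_parity_pairs :: "nat \<Rightarrow> (nat \<times> nat) set" where
  "opposite_parity_pairs n = {(A, B). A * B = 2 * n \<and> B mod 3 \<noteq> 0 \<and> odd (A + B)}"

text \<open>Both integrality conditions say that b is 1 modulo 3 and a + b is odd. As a and b have
  the same sign, |a| and |b| determine the pair: the residue of |b| modulo 3 decides the common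
  sign.\<close>

lemma sum_rhs_term:
  assumes "n > 0"
  shows "(\<Sum>(a, b) | 2 * int n = a * b \<and> N_of a b \<in> \<int> \<and> N_tilde a b \<in> \<int>.
      rhs_term a b)
    = (\<Sum>(A, B)\<in>opposite_parity_pairs n. if B < 3 * A then real B / 3 else - real A)"
proof (rule sum.reindex_bij_witness[of _
      "\<lambda>(A, B). if B mod 3 = 1 then (int A, int B) else (- int A, - int B)" "\<lambda>(a, b).
          (nat \<bar>a\<bar>, nat \<bar>b\<bar>)"])
  fix x assume "x \<in> {(a, b). 2 * int n = a * b \<and> N_of a b \<in> \<int> \<and> N_tilde a b \<in>
      \<int>}"
  then obtain a b where x: "x = (a, b)" and ab: "a * b = 2 * int n"
    and d: "6 dvd b - 3 * a - 1" "6 dvd b + 3 * a - 1"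
    by (auto simp: N_of_Ints_iff N_tilde_Ints_iff)
  define A B where "A = nat \<bar>a\<bar>" and "B = nat \<bar>b\<bar>"
  have pos: "a * b > 0" using ab assms by simp
  then have sign: "a > 0 \<and> b > 0 \<or> a < 0 \<and> b < 0" by (simp add: zero_less_mult_iff)
  have b3: "b mod 3 = 1" using d(1) by presburger
  have odd: "odd (a + b)" using d(1) by presburger
  have AB: "a = int A \<and> b = int B \<or> a = - int A \<and> b = - int B"
    using sign by (auto simp: A_def B_def)
  have B3: "B mod 3 = (if b > 0 then 1 else 2)"
    using AB b3 sign by auto presburger+
  show "(case case x of (a, b) \<Rightarrow> (nat \<bar>a\<bar>, nat \<bar>b\<bar>) of (A, B) \<Rightarrow>
      if B mod 3 = 1 then (int A, int B) else (- int A, - int B)) = x"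
    unfolding x prod.case A_def[symmetric] B_def[symmetric] B3 using AB sign by auto
  have "int (A * B) = int (2 * n)" using AB ab by auto
  then have "A * B = 2 * n" by (simp only: of_nat_eq_iff)
  moreover have "odd (A + B)" using AB odd by auto
  ultimately show "(case x of (a, b) \<Rightarrow> (nat \<bar>a\<bar>, nat \<bar>b\<bar>)) \<in>
      opposite_parity_pairs n"
    unfolding x prod.case A_def[symmetric] B_def[symmetric] opposite_parity_pairs_def by (auto simp: B3)
  show "(case case x of (a, b) \<Rightarrow> (nat \<bar>a\<bar>, nat \<bar>b\<bar>) of (A, B)
      \<Rightarrow> if B < 3 * A then real B / 3 else - real A)
      = (case x of (a, b) \<Rightarrow> rhs_term a b)"
    unfolding x prod.case rhs_term_eq[OF pos d] by (simp add: nat_less_iff flip: of_nat_less_iff)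
next
  fix y assume "y \<in> opposite_parity_pairs n"
  then obtain A B where y: "y = (A, B)" and AB: "A * B = 2 * n" and B3: "B mod 3 \<noteq>
      0" and odd: "odd (A + B)"
    by (auto simp: opposite_parity_pairs_def)
  show "(case case y of (A, B) \<Rightarrow> if B mod 3 = 1 then (int A, int B) else (- int A, - int B)
      of (a, b) \<Rightarrow> (nat \<bar>a\<bar>, nat \<bar>b\<bar>)) = y"
    by (simp add: y)
  have *: "2 * int n = int A * int B" using arg_cong[OF AB, of int] by simp
  show "(case y of (A, B) \<Rightarrow> if B mod 3 = 1 then (int A, int B) else (- int A, - int B))
      \<in> {(a, b). 2 * int n = a * b \<and> N_of a b \<in> \<int> \<and> N_tilde a b \<in> \<int>}"
  proof (cases "B mod 3 = 1")
    case True
    then have "6 dvd int B - 3 * int A - 1" "6 dvd int B + 3 * int A - 1"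
      using odd by presburger+
    then show ?thesis by (simp add: y True * N_of_Ints_iff N_tilde_Ints_iff)
  next
    case False
    then have "6 dvd - int B - 3 * - int A - 1" "6 dvd - int B + 3 * - int A - 1"
      using odd B3 by presburger+
    then show ?thesis
      unfolding y prod.case if_not_P[OF False] by (simp add: * N_of_Ints_iff N_tilde_Ints_iff)
  qed
qed

text \<open>B and 3A have product 6n and a difference that is odd and prime to 3, hence 1 or 5
  modulo 6 once they are ordered. Exactly one of the ordered entries is divisible by 3, which
  identifies 3A.\<close>

lemma sum_opposite_parity_pairs:
  assumes "n > 0"
  shows "(\<Sum>(A, B)\<in>opposite_parity_pairs n. if B < 3 * A then real B / 3 else - real A)
    = (\<Sum>(k, c)\<in>wedge_pairs n. if 3 dvd k then - (real k / 3) else real k / 3)"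
proof (rule sum.reindex_bij_witness[of _
      "\<lambda>(k, c). if 3 dvd k then (k div 3, c) else (c div 3, k)" "\<lambda>(A, B). if B < 3 * A
          then (B, 3 * A) else (3 * A, B)"])
  fix x assume "x \<in> opposite_parity_pairs n"
  then obtain A B where x: "x = (A, B)" and AB: "A * B = 2 * n" and B3: "B mod 3 \<noteq>
      0" and odd: "odd (A + B)"
    by (auto simp: opposite_parity_pairs_def)
  have nB: "\<not> 3 dvd B" using B3 by presburger
  show "(case case x of (A, B) \<Rightarrow> if B < 3 * A then (B, 3 * A) else (3 * A, B) of (k, c)
      \<Rightarrow>
      if 3 dvd k then (k div 3, c) else (c div 3, k)) = x"
    using nB by (simp add: x)
  have "\<exists>j. 3 * A = B + 1 + 6 * j \<or> 3 * A = B + 5 + 6 * j" if "B < 3 * A"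
    using that odd B3 by presburger
  moreover have "\<exists>j. B = 3 * A + 1 + 6 * j \<or> B = 3 * A + 5 + 6 * j" if "\<not> B < 3 * A"
    using that odd B3 by presburger
  moreover have "B * (3 * A) = 6 * n" "3 * A * B = 6 * n" "B * A = 2 *
      n" using AB by (simp_all add: mult.commute)
  ultimately show "(case x of (A, B) \<Rightarrow> if B < 3 * A then (B, 3 * A) else (3 * A, B)) \<in>
      wedge_pairs n"
    unfolding x prod.case wedge_pairs_def by (cases "B < 3 * A") simp_all
  show "(case case x of (A, B) \<Rightarrow> if B < 3 * A then (B, 3 * A) else (3 * A, B) of (k, c)
      \<Rightarrow>
      if 3 dvd k then - (real k / 3) else real k / 3) = (case x of (A, B) \<Rightarrow> if B < 3 * A then real B / 3 else - real A)"
    using nB by (simp add: x)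
next
  fix y assume "y \<in> wedge_pairs n"
  then obtain k c j where y: "y = (k, c)" and kc: "k * c = 6 * n" and c: "c = k + 1 + 6 * j \<or> c = k
      + 5 + 6 * j"
    by (auto simp: wedge_pairs_def)
  have "k < c" "odd (k + c)" "\<not> 3 dvd c \<or> \<not> 3 dvd k" using c by presburger+
  have "3 dvd k * c" unfolding kc by simp
  then have "3 dvd k \<or> 3 dvd c" by (simp add: prime_dvd_mult_iff)
  then consider "3 dvd k" "\<not> 3 dvd c" | "3 dvd c" "\<not> 3 dvd k"
    using \<open>\<not> 3 dvd c \<or> \<not> 3 dvd k\<close> by blast
  then have "(case case y of (k, c) \<Rightarrow> if 3 dvd k then (k div 3, c) else (c div 3, k) of (A,
      B) \<Rightarrow>
      if B < 3 * A then (B, 3 * A) else (3 * A, B)) = y \<and>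
    (case y of (k, c) \<Rightarrow> if 3 dvd k then (k div 3, c) else (c div 3, k)) \<in> opposite_parity_pairs n"
  proof cases
    case 1
    then obtain A where A: "k = 3 * A" by (elim dvdE)
    with 1 have i: "(case y of (k, c) \<Rightarrow> if 3 dvd k then (k div 3, c) else (c div 3, k)) = (A, c)"
      by (simp add: y)
    have "A * c = 2 * n" using kc by (simp add: A)
    moreover have "odd (A + c)" using \<open>odd (k + c)\<close> by (simp add: A)
    moreover have "c mod 3 \<noteq> 0" using 1(2) by presburger
    ultimately show ?thesis
      unfolding i using \<open>k < c\<close> by (simp add: y A opposite_parity_pairs_def)
  next
    case 2
    then obtain B where B: "c = 3 * B" by (elim dvdE)
    with 2 have i: "(case y of (k, c) \<Rightarrow> if 3 dvd k then (k div 3, c) else (c div 3, k)) = (B, k)"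
      by (simp add: y)
    have "3 * (B * k) = 3 * (2 * n)" using kc by (simp add: B mult_ac)
    then have "B * k = 2 * n" by simp
    moreover have "odd (B + k)" using \<open>odd (k + c)\<close> by (simp add: B)
    moreover have "k mod 3 \<noteq> 0" using 2(2) by presburger
    ultimately show ?thesis
      unfolding i using \<open>k < c\<close> by (simp add: y B opposite_parity_pairs_def)
  qed
  then show "(case case y of (k, c) \<Rightarrow> if 3 dvd k then (k div 3, c) else (c div 3, k) of (A,
      B) \<Rightarrow>
      if B < 3 * A then (B, 3 * A) else (3 * A, B)) = y"
    "(case y of (k, c) \<Rightarrow> if 3 dvd k then (k div 3, c) else (c div 3, k)) \<in>
        opposite_parity_pairs n"
    by (rule conjunct1, rule conjunct2)
qed

theorem theorem1p1:
  fixes n :: nat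
  assumes "n > 0"
  shows "(\<Sum>m | 3 * m\<^sup>2 + m \<le> 2 * int n.
            (real_of_int m + 1/6) * c_f (nat (int n - (3 * m\<^sup>2 + m) div 2)))
       = 4/3 * divisor_sigma (real n) - 16/3 * divisor_sigma (real n / 2)
         - 2 * (\<Sum>(a, b) | 2 * int n = a * b \<and> N_of a b \<in> \<int> \<and> N_tilde a b \<in> \<int>.
                  sgn_plus (N_of a b) * sgn_plus (N_tilde a b)
                    * (\<bar>N_of a b + 1/6\<bar> - \<bar>N_tilde a b + 1/6\<bar>))"
proof -
  let ?W = "\<Sum>(k, c)\<in>wedge_pairs n. if 3 dvd k then real k else - real k"
  \<comment> \<open>The factor 6 turns m + 1/6 into the weight 6m + 1 of
    \<open>theta\<close>.\<close>
  have "6 * (\<Sum>m | 3 * m\<^sup>2 + m \<le> 2 * int n.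
            (real_of_int m + 1/6) * c_f (nat (int n - (3 * m\<^sup>2 + m) div 2))) = fps_nth (theta * mock_f) n"
    unfolding nth_theta_mult c_f_def sum_distrib_left by (rule sum.cong) (simp_all add: algebra_simps)
  also have "\<dots> = 8 * (divisor_sigma (real n) - 4 * divisor_sigma (real n / 2)) + 4 * ?W"
    by (simp only: nth_theta_mock_f[OF assms] sum_alternating_divisors[OF assms])
  finally have L: "6 * (\<Sum>m | 3 * m\<^sup>2 + m \<le> 2 * int n.
            (real_of_int m + 1/6) * c_f (nat (int n - (3 * m\<^sup>2 + m) div 2)))
      = 8 * (divisor_sigma (real n) - 4 * divisor_sigma (real n / 2)) + 4 * ?W" .
  have "(\<Sum>(a, b) | 2 * int n = a * b \<and> N_of a b \<in> \<int> \<and> N_tilde a b \<in> \<int>.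
                  sgn_plus (N_of a b) * sgn_plus (N_tilde a b)
                    * (\<bar>N_of a b + 1/6\<bar> - \<bar>N_tilde a b + 1/6\<bar>))
      = (\<Sum>(k, c)\<in>wedge_pairs n. if 3 dvd k then - (real k / 3) else real k / 3)"
    using sum_rhs_term[OF assms] sum_opposite_parity_pairs[OF assms] by (simp only: rhs_term_def)
  also have "\<dots> = - (1/3) * ?W"
    unfolding sum_distrib_left by (rule sum.cong) auto
  finally show ?thesis using L by simp
qed

end
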